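(* If $G$ is a (finite simple) graph then $$\overline X_G=\sum_{D\in\mathfrak{m}\mathsf{AO}(G)}\overline\Gamma(D),$$ and consequently the symmetric power series $\overline X_G$ is multifundamental positive, that is, it can be expressed as a possibly infinite sum of (not necessarily distinct) multifundamental quasisymmetric functions $\overline L_\alpha$.
   Context: $\mathbb{P}=\{1,2,3,\dots\}$, $[n]=\{1,\dots,n\}$, and $\mathsf{Set}(\mathbb{P})$ is the set of finite nonempty subsets of $\mathbb{P}$. For a map $\kappa:V\to\mathsf{Set}(\mathbb{P})$ let $x^\kappa=\prod_{v\in V}\prod_{j\in\kappa(v)}x_j$, where $x_1,x_2,\dots$ are commuting variables. For $S,T\in\mathsf{Set}(\mathbb{P})$ write $S\prec T$ if $\max S<\min T$ and $S\preceq T$ if $\max S\le\min T$. Kromatic symmetric function: $\overline X_G=\sum_\kappa x^\kappa$ over all maps $\kappa:V(G)\to\mathsf{Set}(\mathbb{P})$ with $\kappa(u)\cap\kappa(v)=\varnothing$ for all $\{u,v\}\in E(G)$. For a directed acyclic graph $D$, $\overline\Gamma(D)=\sum_\kappa x^\kappa$ over all $\kappa:V(D)\to\mathsf{Set}(\mathbb{P})$ with $\kappa(u)\prec\kappa(v)$ for every edge $u\to v$ of $D$. Multifundamental quasisymmetric functions: for $n\in\mathbb{N}$ and $S\subseteq[n-1]$, $\overline L_{n,S}=\sum x^{A_1}x^{A_2}\cdots x^{A_n}$, where $x^A=\prod_{j\in A}x_j$ and the sum is over all $A_1,\dots,A_n\in\mathsf{Set}(\mathbb{P})$ with $A_i\preceq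 A_{i+1}$ for $i\in[n-1]\setminus S$ and $A_i\prec A_{i+1}$ for $i\in S$. For a composition $\alpha=(\alpha_1,\dots,\alpha_l)$ (finite sequence of positive integers) of $n$, $\overline L_\alpha=\overline L_{n,I(\alpha)}$ with $I(\alpha)=\{\alpha_1,\alpha_1+\alpha_2,\dots\}\setminus\{n\}$. Acyclic multi-orientations: for $\alpha:V(G)\to\mathbb{P}$, the clan graph $\mathsf{Clan}_\alpha(G)$ has vertices $(v,i)$ with $v\in V(G)$, $1\le i\le\alpha(v)$, and edges $\{(v,i),(w,j)\}$ whenever $\{v,w\}\in E(G)$, or $v=w$ and $i\ne j$. An acyclic multi-orientation of $G$ is an acyclic orientation of $\mathsf{Clan}_\alpha(G)$ for some $\alpha$ such that for each $v\in V(G)$ and $1\le i\le\alpha(v)-1$ there are at least two directed paths from $(v,i+1)$ to $(v,i)$. $\mathfrak{m}\mathsf{AO}(G)$ is the set of all acyclic multi-orientations of $G$; two are equal if and only if they have the same vertices and the same directed edges (not merely if isomorphic). *)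

theory Defs
  imports "Graph_Theory.Graph_Theory" "HOL-Library.Multiset" "HOL-Library.FuncSet"
begin

section \<open>Formal power series in countably many commuting variables\<close>

text \<open>A monomial is the finite multiset of the indices of its variables, so multiplication of
  monomials is addition of multisets; a power series maps a monomial to its coefficient.
  The variables are $x_1, x_2, \dots$: the index 0 never occurs below.\<close>

type_synonym pseries = "nat multiset \<Rightarrow> int"

definition monomial_series :: "nat multiset \<Rightarrow> pseries" where
  "monomial_series m = (\<lambda>m'. if m' = m then 1 else 0)"

text \<open>Possibly infinite sums of power series are taken coefficientwise. They are meaningful only
  for families that are locally finite, i.e. in which each monomial occurs in finitely many
  members.\<close>

definition locally_finite :: "('i \<Rightarrow> pseries) \<Rightarrow> 'i set \<Rightarrow> bool" where
  "locally_finite f I \<longleftrightarrow> (\<forall>m. finite {i \<in> I. f i m \<noteq> 0})"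

definition formal_sum :: "('i \<Rightarrow> pseries) \<Rightarrow> 'i set \<Rightarrow> pseries" where
  "formal_sum f I = (\<lambda>m. \<Sum>i \<in> {i \<in> I. f i m \<noteq> 0}. f i m)"

definition has_formal_sum :: "('i \<Rightarrow> pseries) \<Rightarrow> 'i set \<Rightarrow> pseries \<Rightarrow> bool" where
  "has_formal_sum f I F \<longleftrightarrow> locally_finite f I \<and> F = formal_sum f I"

section \<open>Set-valued maps\<close>

definition SetP :: "nat set set" where
  "SetP = {S. finite S \<and> S \<noteq> {} \<and> S \<subseteq> {1..}}"

definition set_prec :: "nat set \<Rightarrow> nat set \<Rightarrow> bool" where
  "set_prec S T \<longleftrightarrow> Max S < Min T"

definition set_preceq :: "nat set \<Rightarrow> nat set \<Rightarrow> bool" where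
  "set_preceq S T \<longleftrightarrow> Max S \<le> Min T"

definition xpow :: "'v set \<Rightarrow> ('v \<Rightarrow> nat set) \<Rightarrow> pseries" where
  "xpow V \<kappa> = monomial_series (\<Sum>v\<in>V. \<Sum>j\<in>\<kappa> v. {#j#})"

text \<open>All the series below that are sums of monomials \<open>xpow V \<kappa>\<close> with \<open>V\<close> finite are
  well defined.\<close>

lemma locally_finite_xpow:
  assumes V: "finite V" and K: "K \<subseteq> V \<rightarrow>\<^sub>E SetP"
  shows "locally_finite (xpow V) K"
  unfolding locally_finite_def
proof
  fix m
  have "{\<kappa> \<in> K. xpow V \<kappa> m \<noteq> 0} \<subseteq> V \<rightarrow>\<^sub>E Pow (set_mset m)"
  proof
    fix \<kappa> assume "\<kappa> \<in> {\<kappa> \<in> K. xpow V \<kappa> m \<noteq> 0}"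
    then have k: "\<kappa> \<in> V \<rightarrow>\<^sub>E SetP" and m: "m = (\<Sum>v\<in>V. \<Sum>j\<in>\<kappa> v. {#j#})"
      using K by (auto simp: xpow_def monomial_series_def split: if_splits)
    have "\<kappa> v \<subseteq> set_mset m" if "v \<in> V" for v
    proof -
      have "finite (\<kappa> v)" using k that by (auto simp: SetP_def PiE_iff)
      then have "set_mset (\<Sum>j\<in>\<kappa> v. {#j#}) = \<kappa> v" by (simp add: set_mset_sum)
      moreover have "set_mset m = (\<Union>v\<in>V. set_mset (\<Sum>j\<in>\<kappa> v. {#j#}))"
        unfolding m using V by (rule set_mset_sum)
      ultimately show ?thesis using that by blast
    qed
    then show "\<kappa> \<in> V \<rightarrow>\<^sub>E Pow (set_mset m)" using k by (auto simp: PiE_iff)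
  qed
  moreover have "finite (V \<rightarrow>\<^sub>E Pow (set_mset m))" using V by (intro finite_PiE) auto
  ultimately show "finite {\<kappa> \<in> K. xpow V \<kappa> m \<noteq> 0}" by (rule finite_subset)
qed

section \<open>The power series\<close>

text \<open>Finite simple graphs are symmetric loop-free finite digraphs (locale \<open>pair_graph\<close>):
  an edge $\{u,v\}$ is the pair of arcs \<open>(u, v)\<close>, \<open>(v, u)\<close>.\<close>

definition Kromatic :: "'a pair_pre_digraph \<Rightarrow> pseries" where
  "Kromatic G = formal_sum (xpow (pverts G))
     {\<kappa> \<in> pverts G \<rightarrow>\<^sub>E SetP. \<forall>(u, v) \<in> parcs G. \<kappa> u \<inter> \<kappa> v = {}}"

definition Gamma_bar :: "'a pair_pre_digraph \<Rightarrow> pseries" where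
  "Gamma_bar D = formal_sum (xpow (pverts D))
     {\<kappa> \<in> pverts D \<rightarrow>\<^sub>E SetP. \<forall>(u, v) \<in> parcs D. set_prec (\<kappa> u) (\<kappa> v)}"

definition Lbar_set :: "nat \<Rightarrow> nat set \<Rightarrow> pseries" where
  "Lbar_set n S = formal_sum (xpow {1..n})
     {A \<in> {1..n} \<rightarrow>\<^sub>E SetP.
        (\<forall>i \<in> {1..n-1} - S. set_preceq (A i) (A (i+1))) \<and>
        (\<forall>i \<in> S. set_prec (A i) (A (i+1)))}"

definition is_composition :: "nat list \<Rightarrow> bool" where
  "is_composition \<alpha> \<longleftrightarrow> (\<forall>a \<in> set \<alpha>. 1 \<le> a)"

definition comp_set :: "nat list \<Rightarrow> nat set" where
  "comp_set \<alpha> = {sum_list (take k \<alpha>) | k. 1 \<le> k \<and> k \<le> length \<alpha>} - {sum_list \<alpha>}"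

definition Lbar :: "nat list \<Rightarrow> pseries" where
  "Lbar \<alpha> = Lbar_set (sum_list \<alpha>) (comp_set \<alpha>)"

text \<open>Index sets contained in the natural numbers suffice: every \<open>Lbar \<alpha>\<close> is nonzero, so a
  locally finite family of such series is countable.\<close>

definition multifundamental_positive :: "pseries \<Rightarrow> bool" where
  "multifundamental_positive F \<longleftrightarrow>
     (\<exists>(I :: nat set) \<alpha>. (\<forall>i\<in>I. is_composition (\<alpha> i)) \<and> has_formal_sum (\<lambda>i. Lbar (\<alpha> i)) I F)"

section \<open>Acyclic multi-orientations\<close>

definition Clan :: "('a \<Rightarrow> nat) \<Rightarrow> 'a pair_pre_digraph \<Rightarrow> ('a \<times> nat) pair_pre_digraph" where
  "Clan \<alpha> G =
     (let W = (SIGMA v : pverts G. {1..\<alpha> v})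
      in \<lparr> pverts = W,
           parcs = {((v, i), (w, j)) | v i w j. (v, i) \<in> W \<and> (w, j) \<in> W \<and>
                      ((v, w) \<in> parcs G \<or> v = w \<and> i \<noteq> j)} \<rparr>)"

definition acyclic_orientation :: "'b pair_pre_digraph \<Rightarrow> 'b pair_pre_digraph \<Rightarrow> bool" where
  "acyclic_orientation H D \<longleftrightarrow>
     pverts D = pverts H \<and> parcs D \<subseteq> parcs H \<and>
     (\<forall>(u, v) \<in> parcs H. (u, v) \<in> parcs D \<longleftrightarrow> (v, u) \<notin> parcs D) \<and>
     acyclic (parcs D)"

definition directed_paths :: "'b pair_pre_digraph \<Rightarrow> 'b \<Rightarrow> 'b \<Rightarrow> ('b \<times> 'b) list set" where
  "directed_paths D u v = {p. pre_digraph.apath (with_proj D) u p v}"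

definition mAO :: "'a pair_pre_digraph \<Rightarrow> ('a \<times> nat) pair_pre_digraph set" where
  "mAO G = {D. \<exists>\<alpha>. (\<forall>v \<in> pverts G. 1 \<le> \<alpha> v) \<and> acyclic_orientation (Clan \<alpha> G) D \<and>
     (\<forall>v \<in> pverts G. \<forall>i \<in> {1..\<alpha> v - 1}.
        \<exists>p \<in> directed_paths D (v, i+1) (v, i). \<exists>q \<in> directed_paths D (v, i+1) (v, i). p \<noteq> q)}"

end

theory Submission
  imports Defs "HOL-Library.Product_Lexorder" "HOL-Library.Countable_Set"
begin

text \<open>The first identity is a bijection that preserves monomials. A pair of an acyclic
  multi-orientation \<open>D\<close> and a map \<open>\<kappa>\<close> that is increasing along its arcs assigns sets
  \<open>\<kappa> (v, 1)\<close>, \<open>\<kappa> (v, 2)\<close>, \<open>\<dots>\<close> to the copies of each vertex \<open>v\<close>, each entirely below its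
  predecessor. Their disjoint union is a proper set colouring \<open>K\<close>, because adjacent vertices have
  comparable, hence disjoint, layers. Conversely, \<open>K\<close> determines the layers: two colours of \<open>v\<close> belong to the
  same layer exactly if no colour of a neighbour of \<open>v\<close> lies between them. They have to be
  split if there is such a colour, since the layer containing both could not be compared with the
  neighbour's layer; and a split requires such a colour, since the second directed path from
  \<open>(v, i+1)\<close> to \<open>(v, i)\<close> has to pass through a neighbour. So the condition of two paths is exactly
  what selects one splitting of each \<open>K v\<close>. The two halves are
  \<open>multi_orientation_determined\<close> and \<open>layered_orientation_multi_orientation\<close>.

  For positivity, the series of each acyclic digraph is expanded in the manner of
  \<open>P\<close>-partitions. The vertices get distinct labels that decrease along arcs. Reading all pairs of
  a colour and a vertex by colour, then by label, and contracting runs of the same vertex gives a word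
  in the vertices; the colours in the successive runs form a sequence of sets with
  \<open>A i \<preceq> A (i+1)\<close>, and with \<open>A i \<prec> A (i+1)\<close> where the label descends. The maps with a given
  word therefore contribute one multifundamental function (\<open>Gamma_bar_sum_Lbar_set\<close>). Nonnegativity
  of the coefficients lets the two locally finite sums be combined into one.

  In both parts the pieces are recovered from their union as the classes of a convex equivalence
  relation on a finite chain, whose numbering is unique (\<open>block_numbering_unique\<close>).\<close>

section \<open>Coefficients and formal sums\<close>

definition content :: "'v set \<Rightarrow> ('v \<Rightarrow> nat set) \<Rightarrow> nat multiset" where
  "content V \<kappa> = (\<Sum>v\<in>V. \<Sum>j\<in>\<kappa> v. {#j#})"

lemma xpow_nonzero_iff: "xpow V \<kappa> m \<noteq> 0 \<longleftrightarrow> content V \<kappa> = m"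
  by (auto simp: xpow_def content_def monomial_series_def)

lemma formal_sum_xpow: "formal_sum (xpow V) K m = int (card {\<kappa> \<in> K. content V \<kappa> = m})"
proof -
  have "formal_sum (xpow V) K m = (\<Sum>\<kappa> \<in> {\<kappa> \<in> K. content V \<kappa> = m}. 1)"
    unfolding formal_sum_def xpow_nonzero_iff
    by (rule sum.cong) (auto simp: xpow_def content_def monomial_series_def)
  then show ?thesis by simp
qed

text \<open>The coefficients count maps, so the identity is a count of fibres. Local finiteness of the
  family holds because only finitely many maps in \<open>K\<close> have a given monomial, and each of them comes
  from a single index.
  Both expansions in this theory, over multi-orientations and over words, are instances.\<close>

lemma has_formal_sum_xpow_by_bijection:
  assumes V: "finite V" and K: "K \<subseteq> V \<rightarrow>\<^sub>E SetP"
    and bij: "bij_betw (\<lambda>(i, \<kappa>). \<phi> i \<kappa>) (SIGMA i:I. L i) K"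
    and content: "\<And>i \<kappa>. i \<in> I \<Longrightarrow> \<kappa> \<in> L i \<Longrightarrow> content V (\<phi> i \<kappa>) = content (W i) \<kappa>"
  shows "has_formal_sum (\<lambda>i. formal_sum (xpow (W i)) (L i)) I (formal_sum (xpow V) K)"
proof -
  let ?f = "\<lambda>i. formal_sum (xpow (W i)) (L i)"
  define S where "S m = (SIGMA i:I. {\<kappa> \<in> L i. content (W i) \<kappa> = m})" for m
  define J where "J m = {i \<in> I. ?f i m \<noteq> 0}" for m
  have bijS: "bij_betw (\<lambda>(i, \<kappa>). \<phi> i \<kappa>) (S m) {\<kappa> \<in> K. content V \<kappa> = m}" for m
  proof (rule bij_betw_subset[OF bij])
    show "S m \<subseteq> (SIGMA i:I. L i)" by (auto simp: S_def)
    have "K = (\<lambda>(i, \<kappa>). \<phi> i \<kappa>) ` (SIGMA i:I. L i)" using bij by (simp add: bij_betw_def)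
    then show "(\<lambda>(i, \<kappa>). \<phi> i \<kappa>) ` S m = {\<kappa> \<in> K. content V \<kappa> = m}"
      using content by (force simp: S_def)
  qed
  have finK: "finite {\<kappa> \<in> K. content V \<kappa> = m}" for m
    using locally_finite_xpow[OF V K] by (simp add: locally_finite_def xpow_nonzero_iff)
  have finS: "finite (S m)" for m
    using bij_betw_finite[OF bijS] finK by blast
  have fin_fibre: "finite {\<kappa> \<in> L i. content (W i) \<kappa> = m}" if "i \<in> I" for i m
  proof (rule finite_subset)
    show "{\<kappa> \<in> L i. content (W i) \<kappa> = m} \<subseteq> snd ` S m" using that by (force simp: S_def)
  qed (simp add: finS)
  have finJ: "finite (J m)" for m
  proof (rule finite_subset)
    show "J m \<subseteq> fst ` S m"
    proof
      fix i assume i: "i \<in> J m"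
      then have "card {\<kappa> \<in> L i. content (W i) \<kappa> = m} \<noteq> 0" by (simp add: J_def formal_sum_xpow)
      then have "{\<kappa> \<in> L i. content (W i) \<kappa> = m} \<noteq> {}" by force
      then show "i \<in> fst ` S m" using i by (force simp: S_def J_def)
    qed
  qed (simp add: finS)
  have SJ: "S m = (SIGMA i:J m. {\<kappa> \<in> L i. content (W i) \<kappa> = m})" for m
  proof -
    have "i \<in> J m" if "i \<in> I" "\<kappa> \<in> L i" "content (W i) \<kappa> = m" for i \<kappa>
    proof -
      have "card {\<kappa> \<in> L i. content (W i) \<kappa> = m} \<noteq> 0"
        unfolding card_0_eq[OF fin_fibre[OF that(1)]] using that by auto
      then show ?thesis using that by (simp add: J_def formal_sum_xpow)
    qed
    then show ?thesis by (auto simp: S_def J_def)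
  qed
  have "formal_sum (xpow V) K m = formal_sum ?f I m" for m
  proof -
    have "formal_sum (xpow V) K m = int (card (S m))"
      by (simp add: formal_sum_xpow bij_betw_same_card[OF bijS])
    also have "card (S m) = (\<Sum>i\<in>J m. card {\<kappa> \<in> L i. content (W i) \<kappa> = m})"
      unfolding SJ using finJ fin_fibre by (intro card_SigmaI) (auto simp: J_def)
    also have "int \<dots> = (\<Sum>i\<in>J m. ?f i m)" by (simp add: formal_sum_xpow)
    also have "\<dots> = formal_sum ?f I m" by (simp add: formal_sum_def[of ?f] J_def)
    finally show ?thesis .
  qed
  then show ?thesis
    using finJ by (auto simp: has_formal_sum_def locally_finite_def J_def)
qed

text \<open>Nonnegative coefficients cannot cancel, so an inner series contributes to a monomial only if
  its own sum does. This is what keeps the joint family locally finite.\<close>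

lemma has_formal_sum_Sigma:
  assumes F: "has_formal_sum f I F"
    and f: "\<And>i. i \<in> I \<Longrightarrow> has_formal_sum (g i) (J i) (f i)"
    and nonneg: "\<And>i j m. i \<in> I \<Longrightarrow> j \<in> J i \<Longrightarrow> 0 \<le> g i j m"
  shows "has_formal_sum (\<lambda>(i, j). g i j) (Sigma I J) F"
proof -
  define I' where "I' m = {i \<in> I. f i m \<noteq> 0}" for m
  define J' where "J' m i = {j \<in> J i. g i j m \<noteq> 0}" for m i
  have finI: "finite (I' m)" for m
    using F by (simp add: I'_def has_formal_sum_def locally_finite_def)
  have finJ: "finite (J' m i)" if "i \<in> I" for m i
    using f[OF that] by (simp add: J'_def has_formal_sum_def locally_finite_def)
  have fsum: "f i m = (\<Sum>j\<in>J' m i. g i j m)" if "i \<in> I" for m i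
    using f[OF that] by (simp add: J'_def has_formal_sum_def formal_sum_def)
  have supp: "{x \<in> Sigma I J. (case x of (i, j) \<Rightarrow> g i j) m \<noteq> 0} = Sigma (I' m) (J' m)" for m
  proof -
    have "f i m \<noteq> 0" if "i \<in> I" "j \<in> J i" "g i j m \<noteq> 0" for i j
    proof -
      have "(\<Sum>j\<in>J' m i. g i j m) \<noteq> 0"
        using that nonneg finJ[of i m]
        by (subst sum_nonneg_eq_0_iff) (auto simp: J'_def)
      then show ?thesis using fsum that by simp
    qed
    then show ?thesis by (auto simp: I'_def J'_def)
  qed
  have "F m = formal_sum (\<lambda>(i, j). g i j) (Sigma I J) m" for m
  proof -
    have "F m = (\<Sum>i\<in>I' m. f i m)"
      using F by (simp add: has_formal_sum_def formal_sum_def I'_def)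
    also have "\<dots> = (\<Sum>i\<in>I' m. \<Sum>j\<in>J' m i. g i j m)"
      by (rule sum.cong) (auto simp: fsum I'_def)
    also have "\<dots> = (\<Sum>(i, j)\<in>Sigma (I' m) (J' m). g i j m)"
      using finI finJ by (intro sum.Sigma) (auto simp: I'_def)
    also have "\<dots> = formal_sum (\<lambda>(i, j). g i j) (Sigma I J) m"
      unfolding formal_sum_def supp by (rule sum.cong) auto
    finally show ?thesis .
  qed
  moreover have "finite (Sigma (I' m) (J' m))" for m
    using finI finJ by (intro finite_SigmaI) (auto simp: I'_def)
  ultimately show ?thesis
    unfolding has_formal_sum_def locally_finite_def supp by auto
qed

section \<open>Multifundamental positivity\<close>

lemma countable_multisets: "countable (UNIV :: 'a::countable multiset set)"
proof -
  have "(UNIV :: 'a multiset set) = range mset" using surj_mset by metis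
  then show ?thesis by (metis countable_image countableI_type)
qed

text \<open>Only countably many indices carry a nonzero series, since there are countably many monomials
  and each meets finitely many indices. The others can be dropped before renumbering by naturals.\<close>

lemma multifundamental_positiveI:
  fixes I :: "'i set"
  assumes comp: "\<And>i. i \<in> I \<Longrightarrow> is_composition (\<alpha> i)"
    and F: "has_formal_sum (\<lambda>i. Lbar (\<alpha> i)) I F"
  shows "multifundamental_positive F"
proof -
  define J where "J = (\<Union>m. {i \<in> I. Lbar (\<alpha> i) m \<noteq> 0})"
  have fin: "finite {i \<in> I. Lbar (\<alpha> i) m \<noteq> 0}" for m
    using F by (simp add: has_formal_sum_def locally_finite_def)
  have "countable J" unfolding J_def
    by (rule countable_UN) (auto intro: countable_finite fin countable_multisets)
  then have inj: "inj_on (to_nat_on J) J" by (rule inj_on_to_nat_on)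
  let ?e = "to_nat_on J" and ?d = "the_inv_into J (to_nat_on J)"
  have d: "?d (?e i) = i" if "i \<in> J" for i
    using inj that by (rule the_inv_into_f_f)
  have inJ: "i \<in> J" if "i \<in> I" "Lbar (\<alpha> i) m \<noteq> 0" for i m
    using that by (auto simp: J_def)
  have JI: "i \<in> I" if "i \<in> J" for i
    using that by (auto simp: J_def)
  have supp: "{k \<in> ?e ` J. Lbar (\<alpha> (?d k)) m \<noteq> 0} = ?e ` {i \<in> I. Lbar (\<alpha> i) m \<noteq> 0}" for m
    using inJ by (auto simp: d JI)
  have "has_formal_sum (\<lambda>k. Lbar (\<alpha> (?d k))) (?e ` J) F"
    unfolding has_formal_sum_def
  proof
    show "locally_finite (\<lambda>k. Lbar (\<alpha> (?d k))) (?e ` J)"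
      by (simp add: locally_finite_def supp fin)
    have "formal_sum (\<lambda>i. Lbar (\<alpha> i)) I m = formal_sum (\<lambda>k. Lbar (\<alpha> (?d k))) (?e ` J) m" for m
    proof -
      have inj': "inj_on ?e {i \<in> I. Lbar (\<alpha> i) m \<noteq> 0}"
        by (rule inj_on_subset[OF inj]) (auto intro: inJ)
      show ?thesis unfolding formal_sum_def supp sum.reindex[OF inj']
        by (rule sum.cong) (auto simp: d inJ)
    qed
    then show "F = formal_sum (\<lambda>k. Lbar (\<alpha> (?d k))) (?e ` J)"
      using F by (auto simp: has_formal_sum_def)
  qed
  moreover have "\<forall>k \<in> ?e ` J. is_composition (\<alpha> (?d k))"
    using comp by (auto simp: d JI)
  ultimately show ?thesis unfolding multifundamental_positive_def
    by (intro exI[of _ "?e ` J"] exI[of _ "\<lambda>k. \<alpha> (?d k)"] conjI)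
qed

lemma Lbar_nonneg: "0 \<le> Lbar \<alpha> m"
  by (simp add: Lbar_def Lbar_set_def formal_sum_xpow)

lemma multifundamental_positive_formal_sum:
  assumes F: "has_formal_sum f I F" and f: "\<And>i. i \<in> I \<Longrightarrow> multifundamental_positive (f i)"
  shows "multifundamental_positive F"
proof -
  obtain J \<alpha> where J: "\<And>i. i \<in> I \<Longrightarrow> (\<forall>j\<in>J i. is_composition (\<alpha> i j)) \<and>
      has_formal_sum (\<lambda>j. Lbar (\<alpha> i j)) (J i :: nat set) (f i)"
    using f unfolding multifundamental_positive_def by metis
  have "has_formal_sum (\<lambda>(i, j). Lbar (\<alpha> i j)) (Sigma I J) F"
    by (rule has_formal_sum_Sigma[OF F]) (use J Lbar_nonneg in auto)
  then have "has_formal_sum (\<lambda>x. Lbar (case x of (i, j) \<Rightarrow> \<alpha> i j)) (Sigma I J) F"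
    by (simp add: case_prod_unfold)
  then show ?thesis by (rule multifundamental_positiveI[rotated]) (use J in auto)
qed

text \<open>Induction on \<open>n\<close>: the last part of the composition is the distance from the largest element
  of \<open>S\<close> to \<open>n\<close>.\<close>

lemma composition_exists:
  assumes "S \<subseteq> {1..n-1}"
  obtains \<alpha> where "is_composition \<alpha>" "sum_list \<alpha> = n" "comp_set \<alpha> = S"
proof -
  have "\<exists>\<alpha>. is_composition \<alpha> \<and> sum_list \<alpha> = n \<and> comp_set \<alpha> = S"
    using assms
  proof (induction n arbitrary: S rule: less_induct)
    case (less n)
    show ?case
    proof (cases "S = {}")
      case True
      show ?thesis
      proof (cases "n = 0")
        case True
        then show ?thesis using \<open>S = {}\<close>
          by (intro exI[of _ "[]"]) (auto simp: is_composition_def comp_set_def)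
      next
        case False
        have "k = 1" if "1 \<le> k" "k \<le> Suc 0" for k :: nat using that by simp
        then show ?thesis using \<open>S = {}\<close> False
          by (intro exI[of _ "[n]"]) (auto simp: is_composition_def comp_set_def)
      qed
    next
      case False
      define s where "s = Max S"
      have fin: "finite S" using less.prems by (rule finite_subset) simp
      then have s: "s \<in> S" using False by (simp add: s_def)
      then have sn: "1 \<le> s" "s < n" using less.prems by force+
      have "S - {s} \<subseteq> {1..s-1}"
      proof
        fix x assume x: "x \<in> S - {s}"
        then have "x \<le> s" "x \<noteq> s" "1 \<le> x" using fin less.prems by (auto simp: s_def)
        then show "x \<in> {1..s-1}" by simp
      qed
      then obtain \<alpha> where \<alpha>: "is_composition \<alpha>" "sum_list \<alpha> = s" "comp_set \<alpha> = S - {s}"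
        using less.IH[OF sn(2)] by blast
      let ?\<beta> = "\<alpha> @ [n - s]"
      have sum_take: "sum_list (take k \<alpha>) \<le> s" for k
        using \<alpha>(2) by (metis append_take_drop_id le_add1 sum_list_append)
      have ne: "\<alpha> \<noteq> []" using \<alpha>(2) sn by auto
      have "comp_set ?\<beta> = S"
      proof
        show "comp_set ?\<beta> \<subseteq> S"
        proof
          fix x assume "x \<in> comp_set ?\<beta>"
          then obtain k where k: "1 \<le> k" "k \<le> length \<alpha> + 1" "x = sum_list (take k ?\<beta>)" "x \<noteq> n"
            using \<alpha>(2) sn by (auto simp: comp_set_def)
          have "k \<noteq> length \<alpha> + 1" using k \<alpha>(2) sn by auto
          then have "k \<le> length \<alpha>" "x = sum_list (take k \<alpha>)" using k by auto
          then have "x = s \<or> x \<in> comp_set \<alpha>" using k \<alpha>(2) unfolding comp_set_def by blast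
          then show "x \<in> S" using \<alpha>(3) s by auto
        qed
        show "S \<subseteq> comp_set ?\<beta>"
        proof
          fix x assume x: "x \<in> S"
          have "\<exists>k. 1 \<le> k \<and> k \<le> length \<alpha> \<and> x = sum_list (take k \<alpha>)"
          proof (cases "x = s")
            case True
            then show ?thesis using \<alpha>(2) ne by (intro exI[of _ "length \<alpha>"]) (auto simp: Suc_le_eq)
          next
            case False
            then have "x \<in> comp_set \<alpha>" using x \<alpha>(3) by auto
            then show ?thesis by (auto simp: comp_set_def)
          qed
          then obtain k where k: "1 \<le> k" "k \<le> length \<alpha>" "x = sum_list (take k \<alpha>)" by blast
          have "x \<noteq> n" using sum_take[of k] k sn by auto
          then show "x \<in> comp_set ?\<beta>" unfolding comp_set_def
            using k \<alpha>(2) sn by (auto intro!: exI[of _ k])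
        qed
      qed
      then show ?thesis using \<alpha> sn by (intro exI[of _ ?\<beta>]) (auto simp: is_composition_def)
    qed
  qed
  then show ?thesis using that by blast
qed

section \<open>Merging set-valued maps\<close>

text \<open>Both bijections below glue pieces of a set-valued map together: \<open>t\<close> sends each piece to the
  vertex that receives it. The pieces are the sets at the copies \<open>(v, i)\<close> in one case and the sets at
  the positions of a word in the other.\<close>

definition merge :: "'w set \<Rightarrow> ('w \<Rightarrow> 'v) \<Rightarrow> 'v set \<Rightarrow> ('w \<Rightarrow> nat set) \<Rightarrow> 'v \<Rightarrow> nat set" where
  "merge W t V \<kappa> = (\<lambda>v\<in>V. \<Union>x\<in>{x \<in> W. t x = v}. \<kappa> x)"

lemma mem_merge: "v \<in> V \<Longrightarrow> c \<in> merge W t V \<kappa> v \<longleftrightarrow> (\<exists>x\<in>W. t x = v \<and> c \<in> \<kappa> x)"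
  by (auto simp: merge_def)

lemma merge_SetP:
  assumes "finite W" "t ` W = V" "\<kappa> \<in> W \<rightarrow>\<^sub>E SetP"
  shows "merge W t V \<kappa> \<in> V \<rightarrow>\<^sub>E SetP"
proof (rule PiE_I)
  fix v assume "v \<in> V"
  then obtain x where x: "x \<in> W" "t x = v" using assms(2) by blast
  have *: "finite (\<kappa> y)" "\<kappa> y \<subseteq> {1..}" "\<kappa> y \<noteq> {}" if "y \<in> W" for y
    using assms(3) that by (auto simp: SetP_def PiE_iff)
  have "(\<Union>y\<in>{y \<in> W. t y = v}. \<kappa> y) \<in> SetP"
    using assms(1) * x by (auto simp: SetP_def)
  then show "merge W t V \<kappa> v \<in> SetP" using \<open>v \<in> V\<close> by (simp add: merge_def)
qed (simp add: merge_def)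

lemma content_merge:
  assumes W: "finite W" "t ` W \<subseteq> V" and V: "finite V" and \<kappa>: "\<kappa> \<in> W \<rightarrow>\<^sub>E SetP"
    and disj: "\<And>x y. x \<in> W \<Longrightarrow> y \<in> W \<Longrightarrow> t x = t y \<Longrightarrow> x \<noteq> y \<Longrightarrow> \<kappa> x \<inter> \<kappa> y = {}"
  shows "content V (merge W t V \<kappa>) = content W \<kappa>"
proof -
  have fin: "finite (\<kappa> x)" if "x \<in> W" for x
    using \<kappa> that by (auto simp: SetP_def PiE_iff)
  have "content V (merge W t V \<kappa>) = (\<Sum>v\<in>V. \<Sum>j\<in>(\<Union>x\<in>{x \<in> W. t x = v}. \<kappa> x). {#j#})"
    unfolding content_def by (rule sum.cong) (auto simp: merge_def)
  also have "\<dots> = (\<Sum>v\<in>V. \<Sum>x\<in>{x \<in> W. t x = v}. \<Sum>j\<in>\<kappa> x. {#j#})"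
    using W fin disj by (intro sum.cong refl sum.UNION_disjoint) auto
  also have "\<dots> = content W \<kappa>"
    unfolding content_def by (rule sum.group[OF W(1) V W(2)])
  finally show ?thesis .
qed

section \<open>Numbering the blocks of a finite chain\<close>

text \<open>To invert \<open>merge\<close> one has to recover the pieces from their union. In both cases the pieces
  are the classes of a convex equivalence relation \<open>R\<close> on a finite chain \<open>P\<close>, ordered through
  \<open>key\<close>, and they are numbered from the bottom to the top of the chain.\<close>

definition block_numbering ::
  "('p \<Rightarrow> 'k::linorder) \<Rightarrow> 'p set \<Rightarrow> ('p \<Rightarrow> 'p \<Rightarrow> bool) \<Rightarrow> nat \<Rightarrow> ('p \<Rightarrow> nat) \<Rightarrow> bool" where
  "block_numbering key P R n r \<longleftrightarrow> r ` P = {1..n} \<and>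
     (\<forall>p\<in>P. \<forall>q\<in>P. key p \<le> key q \<longrightarrow> r p \<le> r q) \<and>
     (\<forall>p\<in>P. \<forall>q\<in>P. r p = r q \<longleftrightarrow> R p q)"

text \<open>The condition on \<open>x\<close> says that it is the least element of its class, so this counts the
  classes that start at or below \<open>p\<close>.\<close>

definition block_index ::
  "('p \<Rightarrow> 'k::linorder) \<Rightarrow> 'p set \<Rightarrow> ('p \<Rightarrow> 'p \<Rightarrow> bool) \<Rightarrow> 'p \<Rightarrow> nat" where
  "block_index key P R p = card {x \<in> P. key x \<le> key p \<and> (\<forall>y\<in>P. R y x \<longrightarrow> key x \<le> key y)}"

text \<open>The numbering maps the least elements of the classes up to \<open>p\<close> bijectively onto
  \<open>{1..r p}\<close>: a number \<open>i \<le> r p\<close> is attained by the least element of its fibre, which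
  lies at or below \<open>p\<close> by monotonicity.\<close>

lemma block_numbering_unique:
  assumes P: "finite P" and key: "inj_on key P" and r: "block_numbering key P R n r" and p: "p \<in> P"
  shows "r p = block_index key P R p"
proof -
  let ?M = "{x \<in> P. key x \<le> key p \<and> (\<forall>y\<in>P. R y x \<longrightarrow> key x \<le> key y)}"
  have img: "r ` P = {1..n}"
    and mono: "\<And>p q. p \<in> P \<Longrightarrow> q \<in> P \<Longrightarrow> key p \<le> key q \<Longrightarrow> r p \<le> r q"
    and ker: "\<And>p q. p \<in> P \<Longrightarrow> q \<in> P \<Longrightarrow> r p = r q \<longleftrightarrow> R p q"
    using r by (auto simp: block_numbering_def)
  have "inj_on r ?M"
  proof (rule inj_onI)
    fix x y assume x: "x \<in> ?M" and y: "y \<in> ?M" and eq: "r x = r y"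
    then have "R x y" "R y x" using ker[of x y] ker[of y x] x y by auto
    then have "key x = key y" using x y by (auto intro: antisym)
    then show "x = y" using x y key by (auto dest: inj_onD)
  qed
  moreover have "r ` ?M = {1..r p}"
  proof
    show "r ` ?M \<subseteq> {1..r p}" using img mono p by fastforce
    show "{1..r p} \<subseteq> r ` ?M"
    proof
      fix i assume i: "i \<in> {1..r p}"
      have "r p \<in> {1..n}" using img p by blast
      then have "i \<in> r ` P" unfolding img using i by simp
      then have F: "{x \<in> P. r x = i} \<noteq> {}" "finite {x \<in> P. r x = i}" using P by auto
      then obtain x where x: "x \<in> P" "r x = i"
        and min: "\<And>y. y \<in> P \<Longrightarrow> r y = i \<Longrightarrow> key x \<le> key y"
        using arg_min_if_finite(1)[OF F(2) F(1), of key] arg_min_least[OF F(2) F(1), of _ key]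
        by auto
      have "key x \<le> key p"
      proof (rule ccontr)
        assume "\<not> key x \<le> key p"
        then have "r p \<le> r x" using mono p x by auto
        then have "r p = i" using i x by simp
        then show False using min[OF p] \<open>\<not> key x \<le> key p\<close> by simp
      qed
      then show "i \<in> r ` ?M" using x min ker by force
    qed
  qed
  ultimately have "card {1..r p} = card ?M" using card_image[of r ?M] by simp
  then show ?thesis by (simp add: block_index_def)
qed

text \<open>Convexity makes \<open>block_index\<close> constant on classes: between two related elements no other class
  can start. Hence it is determined by its values on the least elements of the classes, where it is
  the rank and so takes exactly the values \<open>1, 2, \<dots>\<close>.\<close>

lemma block_numbering_exists:
  assumes P: "finite P" and key: "inj_on key P"
    and refl: "\<And>p. p \<in> P \<Longrightarrow> R p p"
    and sym: "\<And>p q. p \<in> P \<Longrightarrow> q \<in> P \<Longrightarrow> R p q \<Longrightarrow> R q p"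
    and trans: "\<And>p q x. p \<in> P \<Longrightarrow> q \<in> P \<Longrightarrow> x \<in> P \<Longrightarrow> R p q \<Longrightarrow> R q x \<Longrightarrow> R p x"
    and convex: "\<And>p x q. p \<in> P \<Longrightarrow> x \<in> P \<Longrightarrow> q \<in> P \<Longrightarrow> key p \<le> key x \<Longrightarrow> key x \<le> key q \<Longrightarrow>
      R p q \<Longrightarrow> R p x"
  obtains n where "block_numbering key P R n (block_index key P R)"
proof -
  let ?r = "block_index key P R"
  define M where "M = {x \<in> P. \<forall>y\<in>P. R y x \<longrightarrow> key x \<le> key y}"
  have finM: "finite M" using P by (simp add: M_def)
  have r: "?r p = card {x \<in> M. key x \<le> key p}" for p
    unfolding block_index_def M_def by (rule arg_cong[of _ _ card]) auto
  have least: "\<exists>x\<in>M. R x p \<and> key x \<le> key p" if p: "p \<in> P" for p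
  proof -
    have F: "{x \<in> P. R x p} \<noteq> {}" "finite {x \<in> P. R x p}" using P p refl by auto
    then obtain x where x: "x \<in> P" "R x p"
        and min: "\<And>y. y \<in> P \<Longrightarrow> R y p \<Longrightarrow> key x \<le> key y"
      using arg_min_if_finite(1)[OF F(2) F(1), of key] arg_min_least[OF F(2) F(1), of _ key]
      by auto
    then have "x \<in> M" unfolding M_def using trans p by blast
    then show ?thesis using x min[OF p refl[OF p]] by blast
  qed
  have mono: "?r p \<le> ?r q" if "key p \<le> key q" for p q
    unfolding r using finM that by (intro card_mono) auto
  have same: "{x \<in> M. key x \<le> key p} = {x \<in> M. key x \<le> key q}"
    if pq: "p \<in> P" "q \<in> P" "R p q" "key p \<le> key q" for p q
  proof -
    have "key x \<le> key p" if x: "x \<in> M" "key x \<le> key q" for x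
    proof (rule ccontr)
      assume nle: "\<not> key x \<le> key p"
      then have "R p x" using convex[of p x q] pq x by (auto simp: M_def)
      then show False using x pq nle by (auto simp: M_def)
    qed
    then show ?thesis using pq by auto
  qed
  have ker1: "R p q" if pq: "p \<in> P" "q \<in> P" "?r p = ?r q" "key p \<le> key q" for p q
  proof -
    have "{x \<in> M. key x \<le> key p} = {x \<in> M. key x \<le> key q}"
      using finM pq unfolding r by (intro card_subset_eq) auto
    then obtain x where x: "x \<in> M" "R x q" "key x \<le> key p" using least[OF pq(2)] by blast
    then have "R x p" using convex[of x p q] pq by (auto simp: M_def)
    have "x \<in> P" using x by (simp add: M_def)
    show ?thesis
      using trans[OF pq(1) \<open>x \<in> P\<close> pq(2) sym[OF \<open>x \<in> P\<close> pq(1) \<open>R x p\<close>] x(2)] .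
  qed
  have ker: "?r p = ?r q \<longleftrightarrow> R p q" if pq: "p \<in> P" "q \<in> P" for p q
  proof
    assume "?r p = ?r q"
    then show "R p q"
      using ker1[OF pq] ker1[OF pq(2,1)] sym[OF pq(2,1)] by (cases "key p \<le> key q") auto
  next
    assume "R p q"
    then have "{x \<in> M. key x \<le> key p} = {x \<in> M. key x \<le> key q}"
      using same[OF pq] same[OF pq(2,1), symmetric] sym[OF pq] linear by blast
    then show "?r p = ?r q" unfolding r by (rule arg_cong)
  qed
  have "?r ` M = {1..card M}"
  proof (rule card_subset_eq)
    show "?r ` M \<subseteq> {1..card M}"
    proof
      fix i assume "i \<in> ?r ` M"
      then obtain x where x: "x \<in> M" "i = ?r x" by blast
      have "card {x} \<le> i" unfolding x(2) r by (rule card_mono) (use finM x in auto)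
      moreover have "i \<le> card M" unfolding x(2) r by (rule card_mono) (use finM in auto)
      ultimately show "i \<in> {1..card M}" by simp
    qed
    have "inj_on ?r M"
    proof (rule inj_onI)
      fix x y assume xy: "x \<in> M" "y \<in> M" "?r x = ?r y"
      then have xyP: "x \<in> P" "y \<in> P" by (auto simp: M_def)
      then have "R x y" "R y x" using ker[of x y] ker[of y x] xy by auto
      then have "key x = key y" using xy xyP by (auto simp: M_def intro: antisym)
      then show "x = y" using xyP key by (auto dest: inj_onD)
    qed
    then show "card (?r ` M) = card {1..card M}" by (simp add: card_image)
  qed simp
  moreover have "?r ` P = ?r ` M"
  proof
    show "?r ` P \<subseteq> ?r ` M"
    proof
      fix i assume "i \<in> ?r ` P"
      then obtain p where p: "p \<in> P" "i = ?r p" by blast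
      obtain x where x: "x \<in> M" "R x p" using least[OF p(1)] by blast
      then have "?r x = ?r p" using ker[of x p] p by (auto simp: M_def)
      then show "i \<in> ?r ` M" using x(1) p(2) by (intro image_eqI[of _ _ x]) simp_all
    qed
  qed (auto simp: M_def)
  ultimately have "block_numbering key P R (card M) ?r"
    unfolding block_numbering_def using mono ker by auto
  then show ?thesis by (rule that)
qed

section \<open>Increasing set-valued maps\<close>

lemma set_prec_iff:
  assumes "S \<in> SetP" "T \<in> SetP"
  shows "set_prec S T \<longleftrightarrow> (\<forall>c\<in>S. \<forall>d\<in>T. c < d)"
  using assms unfolding set_prec_def SetP_def by (auto simp: Max_less_iff)

lemma set_preceq_iff:
  assumes "S \<in> SetP" "T \<in> SetP"
  shows "set_preceq S T \<longleftrightarrow> (\<forall>c\<in>S. \<forall>d\<in>T. c \<le> d)"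
  using assms unfolding set_preceq_def SetP_def by auto

lemma SetP_nonempty: "S \<in> SetP \<Longrightarrow> \<exists>c. c \<in> S"
  by (auto simp: SetP_def)

lemma SetP_subset: "S \<in> SetP \<Longrightarrow> T \<subseteq> S \<Longrightarrow> T \<noteq> {} \<Longrightarrow> T \<in> SetP"
  by (auto simp: SetP_def intro: finite_subset)

definition proper_set_colorings :: "'a pair_pre_digraph \<Rightarrow> ('a \<Rightarrow> nat set) set" where
  "proper_set_colorings G =
     {\<kappa> \<in> pverts G \<rightarrow>\<^sub>E SetP. \<forall>(u, v) \<in> parcs G. \<kappa> u \<inter> \<kappa> v = {}}"

definition increasing_set_maps :: "'a pair_pre_digraph \<Rightarrow> ('a \<Rightarrow> nat set) set" where
  "increasing_set_maps D =
     {\<kappa> \<in> pverts D \<rightarrow>\<^sub>E SetP. \<forall>(u, v) \<in> parcs D. set_prec (\<kappa> u) (\<kappa> v)}"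

lemma increasing_set_maps_less:
  assumes "\<kappa> \<in> increasing_set_maps D" "parcs D \<subseteq> pverts D \<times> pverts D"
    and "(x, y) \<in> parcs D" "c \<in> \<kappa> x" "d \<in> \<kappa> y"
  shows "c < d"
proof -
  have "set_prec (\<kappa> x) (\<kappa> y)" "\<kappa> x \<in> SetP" "\<kappa> y \<in> SetP"
    using assms by (auto simp: increasing_set_maps_def PiE_iff)
  then show ?thesis using assms by (auto simp: set_prec_iff)
qed

lemma increasing_set_maps_trancl_less:
  assumes \<kappa>: "\<kappa> \<in> increasing_set_maps D" and wf: "parcs D \<subseteq> pverts D \<times> pverts D"
    and "(x, y) \<in> (parcs D)\<^sup>+" "c \<in> \<kappa> x" "d \<in> \<kappa> y"
  shows "c < d"
  using assms(3-)
proof (induction arbitrary: d rule: trancl_induct)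
  case (base y)
  then show ?case using increasing_set_maps_less[OF \<kappa> wf] by blast
next
  case (step y z)
  have "y \<in> pverts D" using step wf by blast
  then obtain e where "e \<in> \<kappa> y"
    using \<kappa> SetP_nonempty by (fastforce simp: increasing_set_maps_def PiE_iff)
  then have "c < e" "e < d" using step increasing_set_maps_less[OF \<kappa> wf] by blast+
  then show ?case by simp
qed

text \<open>Two colours of \<open>v\<close> may stay in the same layer unless a colour of some neighbour lies strictly
  between them. If they stay together across such a colour, the layer is not comparable with the
  neighbour's layer containing it; if they are split without one, no second directed path can
  exist between the layers.\<close>

definition unseparated ::
  "'a pair_pre_digraph \<Rightarrow> ('a \<Rightarrow> nat set) \<Rightarrow> 'a \<Rightarrow> nat \<Rightarrow> nat \<Rightarrow> bool" where
  "unseparated G \<kappa> v c d \<longleftrightarrow>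
     (\<forall>w e. (v, w) \<in> parcs G \<and> e \<in> \<kappa> w \<longrightarrow> \<not> (c < e \<and> e < d) \<and> \<not> (d < e \<and> e < c))"

text \<open>The arcs of a multi-orientation run from \<open>(v, i+1)\<close> to \<open>(v, i)\<close>, so the layers of \<open>v\<close> are
  numbered from the largest colour downwards.\<close>

definition descending :: "nat \<Rightarrow> int" where
  "descending c = - int c"

lemma descending_simps [simp]:
  "descending c \<le> descending d \<longleftrightarrow> d \<le> c" "inj_on descending X"
  by (auto simp: descending_def inj_on_def)

abbreviation color_block_index ::
  "'a pair_pre_digraph \<Rightarrow> ('a \<Rightarrow> nat set) \<Rightarrow> 'a \<Rightarrow> nat \<Rightarrow> nat" where
  "color_block_index G \<kappa> v \<equiv> block_index descending (\<kappa> v) (unseparated G \<kappa> v)"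

section \<open>Two directed paths\<close>

lemma cas_imp_rtrancl:
  "pre_digraph.cas (with_proj D) x p y \<Longrightarrow> set p \<subseteq> parcs D \<Longrightarrow> (x, y) \<in> (parcs D)\<^sup>*"
proof (induction p arbitrary: x)
  case Nil
  then show ?case by (simp add: pre_digraph.cas.simps del: cas_with_proj_eq)
next
  case (Cons a p)
  then have "a = (x, snd a)" "(snd a, y) \<in> (parcs D)\<^sup>*" "a \<in> parcs D"
    by (auto simp: pre_digraph.cas.simps simp del: cas_with_proj_eq)
  then show ?case by (metis converse_rtrancl_into_rtrancl)
qed

lemma directed_pathE:
  assumes "p \<in> directed_paths D x y" "x \<noteq> y"
  obtains z q where "p = (x, z) # q" "(x, z) \<in> parcs D" "(z, y) \<in> (parcs D)\<^sup>*"
    "p = [(x, y)] \<or> (z, y) \<in> (parcs D)\<^sup>+"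
proof -
  have p: "pre_digraph.cas (with_proj D) x p y" "set p \<subseteq> parcs D"
    using assms(1) by (auto simp: directed_paths_def pre_digraph.apath_def pre_digraph.awalk_def
        simp del: cas_with_proj_eq)
  then obtain a q where aq: "p = a # q"
    using assms(2) by (cases p) (auto simp: pre_digraph.cas.simps simp del: cas_with_proj_eq)
  then have a: "a = (x, snd a)" "a \<in> parcs D" and q: "pre_digraph.cas (with_proj D) (snd a) q y"
      "set q \<subseteq> parcs D"
    using p by (auto simp: pre_digraph.cas.simps simp del: cas_with_proj_eq)
  have "p = [(x, y)] \<or> (snd a, y) \<in> (parcs D)\<^sup>+"
  proof (cases q)
    case Nil
    then have "snd a = y" using q by (simp add: pre_digraph.cas.simps del: cas_with_proj_eq)
    then show ?thesis using aq a Nil by simp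
  next
    case (Cons b q')
    then have "fst b = snd a" "b \<in> parcs D" "pre_digraph.cas (with_proj D) (snd b) q' y"
      "set q' \<subseteq> parcs D"
      using q by (auto simp: pre_digraph.cas.simps simp del: cas_with_proj_eq)
    then show ?thesis
      using cas_imp_rtrancl[of D "snd b" q' y] rtrancl_into_trancl2[of "snd a" "snd b"]
      by (metis prod.collapse)
  qed
  then show ?thesis using that[of "snd a" q] aq a cas_imp_rtrancl[OF q] by metis
qed

text \<open>One of two distinct paths differs from the single arc, and its first arc leads to the required
  intermediate vertex.\<close>

lemma two_directed_pathsE:
  assumes "p \<in> directed_paths D x y" "q \<in> directed_paths D x y" "p \<noteq> q" "x \<noteq> y"
  obtains z where "(x, z) \<in> parcs D" "(z, y) \<in> (parcs D)\<^sup>+"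
proof -
  have "p \<noteq> [(x, y)] \<or> q \<noteq> [(x, y)]" using assms(3) by auto
  then show ?thesis
    using directed_pathE[OF assms(1,4)] directed_pathE[OF assms(2,4)] that by metis
qed

lemma arc_directed_path:
  assumes "(x, y) \<in> parcs D" "x \<in> pverts D" "x \<noteq> y"
  shows "[(x, y)] \<in> directed_paths D x y"
  using assms
  by (auto simp: directed_paths_def pre_digraph.apath_def pre_digraph.awalk_def
      pre_digraph.cas.simps pre_digraph.awalk_verts.simps
      simp del: cas_with_proj_eq awalk_verts_with_proj_eq)

lemma two_arcs_directed_path:
  assumes "(x, z) \<in> parcs D" "(z, y) \<in> parcs D" "x \<in> pverts D" "x \<noteq> y" "x \<noteq> z" "z \<noteq> y"
  shows "[(x, z), (z, y)] \<in> directed_paths D x y"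
  using assms
  by (auto simp: directed_paths_def pre_digraph.apath_def pre_digraph.awalk_def
      pre_digraph.cas.simps pre_digraph.awalk_verts.simps
      simp del: cas_with_proj_eq awalk_verts_with_proj_eq)

section \<open>From a multi-orientation to a proper set colouring\<close>

lemma Clan_verts: "pverts (Clan \<alpha> G) = (SIGMA v : pverts G. {1..\<alpha> v})"
  by (simp add: Clan_def)

lemma Clan_arcs: "((v, i), (w, j)) \<in> parcs (Clan \<alpha> G) \<longleftrightarrow>
    v \<in> pverts G \<and> i \<in> {1..\<alpha> v} \<and> w \<in> pverts G \<and> j \<in> {1..\<alpha> w} \<and>
    ((v, w) \<in> parcs G \<or> v = w \<and> i \<noteq> j)"
  by (auto simp: Clan_def)

lemma Clan_cong:
  assumes "\<And>v. v \<in> pverts G \<Longrightarrow> \<alpha> v = \<beta> v"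
  shows "Clan \<alpha> G = Clan \<beta> G"
proof -
  have "(SIGMA v : pverts G. {1..\<alpha> v}) = (SIGMA v : pverts G. {1..\<beta> v})"
    using assms by auto
  then show ?thesis by (simp only: Clan_def)
qed

lemma pair_graph_arcs:
  assumes "pair_graph G" "(v, w) \<in> parcs G"
  shows "v \<in> pverts G" "w \<in> pverts G" "v \<noteq> w" "(w, v) \<in> parcs G"
proof -
  interpret pair_graph G by fact
  show "v \<in> pverts G" "w \<in> pverts G" using assms(2) by (auto dest: wellformed')
  show "v \<noteq> w" using assms(2) no_loops' by blast
  show "(w, v) \<in> parcs G" using assms(2) by (rule arcs_symmetric)
qed

lemma pair_graph_finite: "pair_graph G \<Longrightarrow> finite (pverts G)"
proof -
  assume "pair_graph G"
  then interpret pair_graph G .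
  show "finite (pverts G)" by (rule pair_finite_verts)
qed

text \<open>Transitivity of being unseparated is where properness enters: a separating colour of a
  neighbour cannot coincide with the middle colour.\<close>

lemma block_numbering_color_block_index:
  assumes G: "pair_graph G" and \<kappa>: "\<kappa> \<in> proper_set_colorings G" and v: "v \<in> pverts G"
  obtains n where
    "block_numbering descending (\<kappa> v) (unseparated G \<kappa> v) n (color_block_index G \<kappa> v)"
proof (rule block_numbering_exists[where key = descending and P = "\<kappa> v"
      and R = "unseparated G \<kappa> v"])
  show "finite (\<kappa> v)"
    using \<kappa> v by (auto simp: proper_set_colorings_def SetP_def PiE_iff)
  fix p q x assume pqx: "p \<in> \<kappa> v" "q \<in> \<kappa> v" "x \<in> \<kappa> v"
  assume "unseparated G \<kappa> v p q" "unseparated G \<kappa> v q x"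
  moreover have "q \<notin> \<kappa> w" if "(v, w) \<in> parcs G" for w
    using \<kappa> pqx that by (auto simp: proper_set_colorings_def)
  ultimately show "unseparated G \<kappa> v p x"
    unfolding unseparated_def by (metis linorder_neqE_nat)
qed (auto simp: unseparated_def intro: that)

definition multi_orientation ::
  "('a \<Rightarrow> nat) \<Rightarrow> 'a pair_pre_digraph \<Rightarrow> ('a \<times> nat) pair_pre_digraph \<Rightarrow> bool" where
  "multi_orientation \<alpha> G D \<longleftrightarrow>
     (\<forall>v \<in> pverts G. 1 \<le> \<alpha> v) \<and> acyclic_orientation (Clan \<alpha> G) D \<and>
     (\<forall>v \<in> pverts G. \<forall>i \<in> {1..\<alpha> v - 1}.
        \<exists>p \<in> directed_paths D (v, i+1) (v, i). \<exists>q \<in> directed_paths D (v, i+1) (v, i). p \<noteq> q)"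

lemma mAO_iff: "D \<in> mAO G \<longleftrightarrow> (\<exists>\<alpha>. multi_orientation \<alpha> G D)"
  by (simp add: mAO_def multi_orientation_def)

lemma multi_orientation_verts:
  "multi_orientation \<alpha> G D \<Longrightarrow> pverts D = (SIGMA v : pverts G. {1..\<alpha> v})"
  by (simp add: multi_orientation_def acyclic_orientation_def Clan_verts)

lemma multi_orientation_wf:
  assumes "multi_orientation \<alpha> G D"
  shows "parcs D \<subseteq> pverts D \<times> pverts D"
proof -
  have "parcs D \<subseteq> parcs (Clan \<alpha> G)"
    using assms by (simp add: multi_orientation_def acyclic_orientation_def)
  then show ?thesis
    unfolding multi_orientation_verts[OF assms] by (auto simp: Clan_def)
qed

context
  fixes G :: "'a pair_pre_digraph" and D \<alpha> \<kappa>
  assumes G: "pair_graph G" and D: "multi_orientation \<alpha> G D"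
    and \<kappa>: "\<kappa> \<in> increasing_set_maps D"
begin

private lemma trancl_less: "(x, y) \<in> (parcs D)\<^sup>+ \<Longrightarrow> c \<in> \<kappa> x \<Longrightarrow> d \<in> \<kappa> y \<Longrightarrow> c < d"
  using increasing_set_maps_trancl_less[OF \<kappa> multi_orientation_wf[OF D]] .

private lemma layer_nonempty:
  assumes "v \<in> pverts G" "i \<in> {1..\<alpha> v}"
  shows "\<exists>c. c \<in> \<kappa> (v, i)"
  using \<kappa> assms SetP_nonempty
  by (auto simp: increasing_set_maps_def PiE_iff multi_orientation_verts[OF D])

private lemma adjacent_layers:
  assumes "(v, w) \<in> parcs G" "i \<in> {1..\<alpha> v}" "j \<in> {1..\<alpha> w}"
  shows "(\<forall>c\<in>\<kappa> (v, i). \<forall>d\<in>\<kappa> (w, j). c < d) \<or> (\<forall>c\<in>\<kappa> (v, i). \<forall>d\<in>\<kappa> (w, j). d < c)"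
proof -
  have "((v, i), (w, j)) \<in> parcs (Clan \<alpha> G)"
    using assms pair_graph_arcs[OF G assms(1)] by (simp add: Clan_arcs)
  then have "((v, i), (w, j)) \<in> parcs D \<or> ((w, j), (v, i)) \<in> parcs D"
    using D by (auto simp: multi_orientation_def acyclic_orientation_def)
  then show ?thesis using trancl_less by blast
qed

text \<open>Consecutive copies of a vertex are joined by a directed path by definition; composing these
  paths orders all copies of the vertex.\<close>

private lemma layers_trancl:
  assumes v: "v \<in> pverts G" and ij: "1 \<le> i" "i < j" "j \<le> \<alpha> v"
  shows "((v, j), (v, i)) \<in> (parcs D)\<^sup>+"
proof -
  have consecutive: "((v, k + 1), (v, k)) \<in> (parcs D)\<^sup>+" if "1 \<le> k" "k + 1 \<le> \<alpha> v" for k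
  proof -
    have "k \<in> {1..\<alpha> v - 1}" using that by auto
    then obtain p where "p \<in> directed_paths D (v, k + 1) (v, k)"
      using D v unfolding multi_orientation_def by blast
    then show ?thesis by (rule directed_pathE) auto
  qed
  have "Suc i \<le> j" using ij by simp
  then show ?thesis using \<open>j \<le> \<alpha> v\<close>
  proof (induction j rule: dec_induct)
    case base
    then show ?case using consecutive[of i] ij by simp
  next
    case (step k)
    then have "((v, Suc k), (v, k)) \<in> (parcs D)\<^sup>+" using consecutive[of k] ij by simp
    then show ?case using step by (meson Suc_leD trancl_trans)
  qed
qed

private lemma layers_less:
  assumes "v \<in> pverts G" "1 \<le> i" "i < j" "j \<le> \<alpha> v" "c \<in> \<kappa> (v, j)" "d \<in> \<kappa> (v, i)"
  shows "c < d"
  using trancl_less layers_trancl assms by blast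

text \<open>The second path from \<open>(v, i+1)\<close> to \<open>(v, i)\<close> leaves through some vertex \<open>z\<close> of the clan graph.
  This is not a copy of \<open>v\<close>: every further copy either reaches \<open>(v, i+1)\<close>, or is \<open>(v, i)\<close>, or is
  reached from it, and each possibility closes a cycle. So \<open>z\<close> is a copy of a neighbour, and its
  colours lie between the layers \<open>i+1\<close> and \<open>i\<close>. All later layers lie below layer \<open>i+1\<close>, hence
  they are separated from layer \<open>i\<close> by the same colours.\<close>

private lemma layers_separated:
  assumes v: "v \<in> pverts G" and ij: "1 \<le> i" "i < j" "j \<le> \<alpha> v"
    and cd: "c \<in> \<kappa> (v, j)" "d \<in> \<kappa> (v, i)"
  obtains w l e where "(v, w) \<in> parcs G" "l \<in> {1..\<alpha> w}" "e \<in> \<kappa> (w, l)" "c < e" "e < d"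
proof -
  let ?x = "(v, i + 1)" and ?y = "(v, i)"
  have "i \<in> {1..\<alpha> v - 1}" using ij by auto
  then obtain p q where "p \<in> directed_paths D ?x ?y" "q \<in> directed_paths D ?x ?y" "p \<noteq> q"
    using D v unfolding multi_orientation_def by blast
  then obtain z where z: "(?x, z) \<in> parcs D" "(z, ?y) \<in> (parcs D)\<^sup>+"
    by (rule two_directed_pathsE) auto
  obtain w l where wl: "z = (w, l)" by (cases z)
  have "acyclic (parcs D)"
    using D by (simp add: multi_orientation_def acyclic_orientation_def)
  then have acyc: "(a, a) \<notin> (parcs D)\<^sup>+" for a
    unfolding acyclic_def by blast
  have "(?x, z) \<in> parcs (Clan \<alpha> G)"
    using z D by (auto simp: multi_orientation_def acyclic_orientation_def)
  then have l: "l \<in> {1..\<alpha> w}" and adj: "(v, w) \<in> parcs G \<or> v = w \<and> l \<noteq> i + 1"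
    by (auto simp: wl Clan_arcs)
  have vw: "(v, w) \<in> parcs G"
  proof (rule ccontr)
    assume "(v, w) \<notin> parcs G"
    then have [simp]: "w = v" and "l \<noteq> i + 1" using adj by auto
    then consider "l < i" | "l = i" | "i + 1 < l" by linarith
    then show False
    proof cases
      case 1
      then have "(?y, z) \<in> (parcs D)\<^sup>+" using layers_trancl[of v l i] v ij l wl by auto
      then show False using z acyc by (meson trancl_trans)
    next
      case 2
      then show False using z wl acyc by auto
    next
      case 3
      then have "(z, ?x) \<in> (parcs D)\<^sup>+" using layers_trancl[of v "i + 1" l] v ij l wl by auto
      then show False using z acyc by (meson r_into_trancl trancl_trans)
    qed
  qed
  obtain e where e: "e \<in> \<kappa> z"
    using layer_nonempty[of w l] pair_graph_arcs[OF G vw] l wl by auto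
  have "c < e"
  proof (cases "j = i + 1")
    case True
    then show ?thesis using trancl_less[OF r_into_trancl[OF z(1)] _ e] cd by simp
  next
    case False
    obtain b where b: "b \<in> \<kappa> ?x" using layer_nonempty[of v "i + 1"] v ij by auto
    have "c < b" using layers_less[of v "i + 1" j c b] v ij cd b False by auto
    moreover have "b < e" using trancl_less[OF r_into_trancl[OF z(1)] b e] .
    ultimately show ?thesis by simp
  qed
  moreover have "e < d" using trancl_less[OF z(2) e cd(2)] .
  ultimately show ?thesis using that vw l e wl by blast
qed

abbreviation (input) "merged \<equiv> merge (pverts D) fst (pverts G) \<kappa>"

private lemma mem_merged:
  "v \<in> pverts G \<Longrightarrow> c \<in> merged v \<longleftrightarrow> (\<exists>i\<in>{1..\<alpha> v}. c \<in> \<kappa> (v, i))"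
  by (auto simp: mem_merge multi_orientation_verts[OF D])

lemma multi_orientation_layers_disjoint:
  assumes "x \<in> pverts D" "y \<in> pverts D" "fst x = fst y" "x \<noteq> y"
  shows "\<kappa> x \<inter> \<kappa> y = {}"
proof -
  obtain v i j where xy: "x = (v, i)" "y = (v, j)" "i \<noteq> j"
    using assms by (cases x, cases y) auto
  then have "v \<in> pverts G" "1 \<le> i" "i \<le> \<alpha> v" "1 \<le> j" "j \<le> \<alpha> v"
    using assms by (auto simp: multi_orientation_verts[OF D])
  then have "c \<noteq> d" if "c \<in> \<kappa> (v, i)" "d \<in> \<kappa> (v, j)" for c d
    using layers_less[of v i j d c] layers_less[of v j i c d] that xy(3) by (cases "i < j") auto
  then show ?thesis using xy by blast
qed

lemma multi_orientation_merge_proper: "merged \<in> proper_set_colorings G"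
proof -
  have "finite (pverts D)"
    unfolding multi_orientation_verts[OF D] using pair_graph_finite[OF G] by simp
  moreover have "fst ` pverts D = pverts G"
    using D by (force simp: multi_orientation_verts[OF D] multi_orientation_def)
  moreover have "\<kappa> \<in> pverts D \<rightarrow>\<^sub>E SetP" using \<kappa> by (simp add: increasing_set_maps_def)
  ultimately have "merged \<in> pverts G \<rightarrow>\<^sub>E SetP" by (rule merge_SetP)
  moreover have "merged v \<inter> merged w = {}" if vw: "(v, w) \<in> parcs G" for v w
    using adjacent_layers[OF vw] pair_graph_arcs[OF G vw] by (fastforce simp: mem_merged)
  ultimately show ?thesis unfolding proper_set_colorings_def by blast
qed

text \<open>Adjacent layers are comparable, so no neighbour's colour lies inside the range of a layer, while
  one lies between any two layers of \<open>v\<close>. Hence the layers are the classes of \<open>unseparated\<close>,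
  and uniqueness of the block numbering recovers them from the merged colouring.\<close>

lemma multi_orientation_block_numbering:
  assumes v: "v \<in> pverts G"
  shows "color_block_index G merged v ` merged v = {1..\<alpha> v}"
    and "i \<in> {1..\<alpha> v} \<Longrightarrow> \<kappa> (v, i) = {c \<in> merged v. color_block_index G merged v c = i}"
proof -
  let ?K = merged
  define r where "r c = (THE i. i \<in> {1..\<alpha> v} \<and> c \<in> \<kappa> (v, i))" for c
  have r: "r c = i" if "i \<in> {1..\<alpha> v}" "c \<in> \<kappa> (v, i)" for c i
    unfolding r_def using that v multi_orientation_layers_disjoint[of "(v, i)" "(v, _)"]
    by (intro the_equality) (auto simp: multi_orientation_verts[OF D])
  have rK: "r c \<in> {1..\<alpha> v}" "c \<in> \<kappa> (v, r c)" if "c \<in> ?K v" for c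
    using that r by (auto simp: mem_merged[OF v])
  have Kr: "c \<in> ?K v" if "i \<in> {1..\<alpha> v}" "c \<in> \<kappa> (v, i)" for c i
    using that by (auto simp: mem_merged[OF v])
  have "block_numbering descending (?K v) (unseparated G ?K v) (\<alpha> v) r"
    unfolding block_numbering_def
  proof (intro conjI ballI impI)
    show "r ` ?K v = {1..\<alpha> v}"
    proof
      show "{1..\<alpha> v} \<subseteq> r ` ?K v"
        using layer_nonempty[OF v] r Kr by (metis image_eqI subsetI)
    qed (use rK in auto)
  next
    fix p q assume pq: "p \<in> ?K v" "q \<in> ?K v" "descending p \<le> descending q"
    show "r p \<le> r q"
    proof (rule ccontr)
      assume "\<not> r p \<le> r q"
      then have "p < q" using layers_less[OF v, of "r q" "r p" p q] rK pq by auto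
      then show False using pq by simp
    qed
  next
    fix p q assume pq: "p \<in> ?K v" "q \<in> ?K v"
    have sep: "\<exists>w e. (v, w) \<in> parcs G \<and> e \<in> ?K w \<and> c < e \<and> e < d"
      if cd: "c \<in> ?K v" "d \<in> ?K v" "r d < r c" for c d
    proof -
      obtain w l e where e: "(v, w) \<in> parcs G" "l \<in> {1..\<alpha> w}" "e \<in> \<kappa> (w, l)" "c < e" "e < d"
        using layers_separated[OF v, of "r d" "r c" c d] rK[OF cd(1)] rK[OF cd(2)] cd(3) by auto
      then have "e \<in> ?K w" using pair_graph_arcs[OF G e(1)] mem_merged by blast
      then show ?thesis using e by blast
    qed
    show "r p = r q \<longleftrightarrow> unseparated G ?K v p q"
    proof
      assume eq: "r p = r q"
      show "unseparated G ?K v p q" unfolding unseparated_def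
      proof (intro allI impI)
        fix w e assume we: "(v, w) \<in> parcs G \<and> e \<in> ?K w"
        then obtain j where j: "j \<in> {1..\<alpha> w}" "e \<in> \<kappa> (w, j)"
          using pair_graph_arcs[OF G, of v w] mem_merged by blast
        have "p < e \<and> q < e \<or> e < p \<and> e < q"
          using adjacent_layers[of v w "r p" j] we j rK[OF pq(1)] rK[OF pq(2)] eq by auto
        then show "\<not> (p < e \<and> e < q) \<and> \<not> (q < e \<and> e < p)" by auto
      qed
    next
      assume "unseparated G ?K v p q"
      then have "\<not> r q < r p" "\<not> r p < r q"
        using sep[of p q] sep[of q p] pq unfolding unseparated_def by blast+
      then show "r p = r q" by simp
    qed
  qed
  moreover have "finite (?K v)"
    using multi_orientation_merge_proper v
    by (auto simp: proper_set_colorings_def PiE_iff SetP_def)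
  ultimately have idx: "color_block_index G ?K v c = r c" if "c \<in> ?K v" for c
    using block_numbering_unique[of "?K v" descending _ _ r c] that by simp
  show "color_block_index G ?K v ` ?K v = {1..\<alpha> v}"
    using idx \<open>block_numbering _ _ _ _ r\<close> by (simp add: block_numbering_def cong: image_cong)
  show "\<kappa> (v, i) = {c \<in> ?K v. color_block_index G ?K v c = i}" if "i \<in> {1..\<alpha> v}"
  proof (rule set_eqI)
    fix c
    show "c \<in> \<kappa> (v, i) \<longleftrightarrow> c \<in> {c \<in> ?K v. color_block_index G ?K v c = i}"
      using that idx[of c] r[of i c] rK(2)[of c] Kr[of i c] by auto
  qed
qed

lemma multi_orientation_arcs:
  "parcs D = {(x, y) \<in> parcs (Clan \<alpha> G). set_prec (\<kappa> x) (\<kappa> y)}"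
proof -
  have sub: "parcs D \<subseteq> parcs (Clan \<alpha> G)"
    using D by (simp add: multi_orientation_def acyclic_orientation_def)
  have prec: "set_prec (\<kappa> x) (\<kappa> y)" if "(x, y) \<in> parcs D" for x y
    using \<kappa> that by (auto simp: increasing_set_maps_def)
  have "(x, y) \<in> parcs D" if xy: "(x, y) \<in> parcs (Clan \<alpha> G)" "set_prec (\<kappa> x) (\<kappa> y)" for x y
  proof (rule ccontr)
    assume "(x, y) \<notin> parcs D"
    then have yx: "(y, x) \<in> parcs D"
      using D xy by (auto simp: multi_orientation_def acyclic_orientation_def)
    then have "x \<in> pverts D" "y \<in> pverts D" using multi_orientation_wf[OF D] by auto
    then have S: "\<kappa> x \<in> SetP" "\<kappa> y \<in> SetP" using \<kappa> by (auto simp: increasing_set_maps_def PiE_iff)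
    then obtain c d where "c \<in> \<kappa> x" "d \<in> \<kappa> y" using SetP_nonempty by blast
    then have "c < d" "d < c"
      using prec[OF yx] xy(2) set_prec_iff[OF S] set_prec_iff[OF S(2,1)] by blast+
    then show False by simp
  qed
  then show ?thesis using sub prec by auto
qed

end

text \<open>The merged colouring determines the number of layers over each vertex and the layers
  themselves; the layers in turn determine the direction of every edge.\<close>

lemma multi_orientation_determined:
  assumes G: "pair_graph G"
    and D: "multi_orientation \<alpha> G D" "\<kappa> \<in> increasing_set_maps D"
    and D': "multi_orientation \<alpha>' G D'" "\<kappa>' \<in> increasing_set_maps D'"
    and eq: "merge (pverts D) fst (pverts G) \<kappa> = merge (pverts D') fst (pverts G) \<kappa>'"
  shows "D = D' \<and> \<kappa> = \<kappa>'"
proof -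
  have \<alpha>: "\<alpha> v = \<alpha>' v" if "v \<in> pverts G" for v
  proof -
    have "{1..\<alpha> v} = {1..\<alpha>' v}"
      using multi_orientation_block_numbering(1)[OF G D that]
        multi_orientation_block_numbering(1)[OF G D' that] unfolding eq by (rule trans[OF sym])
    then have "card {1..\<alpha> v} = card {1..\<alpha>' v}" by (rule arg_cong)
    then show ?thesis by simp
  qed
  have verts: "pverts D = pverts D'"
    unfolding multi_orientation_verts[OF D(1)] multi_orientation_verts[OF D'(1)] using \<alpha> by auto
  have "\<kappa> = \<kappa>'"
  proof (rule PiE_ext)
    show "\<kappa> \<in> pverts D \<rightarrow>\<^sub>E SetP" "\<kappa>' \<in> pverts D \<rightarrow>\<^sub>E SetP"
      using D(2) D'(2) verts by (auto simp: increasing_set_maps_def)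
    fix x assume "x \<in> pverts D"
    then obtain v i where vi: "x = (v, i)" "v \<in> pverts G" "i \<in> {1..\<alpha> v}" "i \<in> {1..\<alpha>' v}"
      using multi_orientation_verts[OF D(1)] \<alpha> by auto
    show "\<kappa> x = \<kappa>' x"
      unfolding vi(1) multi_orientation_block_numbering(2)[OF G D vi(2,3)]
        multi_orientation_block_numbering(2)[OF G D' vi(2,4)] eq ..
  qed
  moreover have "parcs D = parcs D'"
    unfolding multi_orientation_arcs[OF G D] multi_orientation_arcs[OF G D'] \<open>\<kappa> = \<kappa>'\<close>
    using Clan_cong[of G \<alpha> \<alpha>'] \<alpha> by simp
  ultimately show ?thesis using verts by (auto intro: pair_pre_digraph.equality)
qed

section \<open>From a proper set colouring to a multi-orientation\<close>

context
  fixes G :: "'a pair_pre_digraph" and K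
  assumes G: "pair_graph G" and K: "K \<in> proper_set_colorings G"
begin

definition "layer_count v = card (color_block_index G K v ` K v)"

definition "layers = (\<lambda>(v, i) \<in> (SIGMA v : pverts G. {1..layer_count v}).
  {c \<in> K v. color_block_index G K v c = i})"

definition "layered_orientation = \<lparr> pverts = (SIGMA v : pverts G. {1..layer_count v}),
  parcs = {(x, y) \<in> parcs (Clan layer_count G). set_prec (layers x) (layers y)} \<rparr>"

lemma layer_numbering:
  assumes v: "v \<in> pverts G"
  shows "block_numbering descending (K v) (unseparated G K v) (layer_count v)
    (color_block_index G K v)"
proof -
  obtain n where n: "block_numbering descending (K v) (unseparated G K v) n (color_block_index G K v)"
    using block_numbering_color_block_index[OF G K v] .
  then have "layer_count v = n" by (simp add: layer_count_def block_numbering_def)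
  then show ?thesis using n by simp
qed

private lemma layer: "v \<in> pverts G \<Longrightarrow> i \<in> {1..layer_count v} \<Longrightarrow>
    layers (v, i) = {c \<in> K v. color_block_index G K v c = i}"
  by (simp add: layers_def)

private lemma layers_SetP: "layers \<in> pverts layered_orientation \<rightarrow>\<^sub>E SetP"
proof (rule PiE_I)
  fix x assume "x \<in> pverts layered_orientation"
  then obtain v i where vi: "x = (v, i)" "v \<in> pverts G" "i \<in> {1..layer_count v}"
    by (auto simp: layered_orientation_def)
  have "K v \<in> SetP" using K vi(2) by (auto simp: proper_set_colorings_def PiE_iff)
  moreover have "i \<in> color_block_index G K v ` K v"
    using layer_numbering[OF vi(2)] vi(3) unfolding block_numbering_def by blast
  ultimately show "layers x \<in> SetP"
    unfolding vi(1) layer[OF vi(2,3)] by (auto intro: SetP_subset)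
next
  fix x assume "x \<notin> pverts layered_orientation"
  then show "layers x = undefined" by (simp add: layered_orientation_def layers_def)
qed

private lemma layer_members:
  assumes "v \<in> pverts G" "i \<in> {1..layer_count v}" "c \<in> layers (v, i)"
  shows "c \<in> K v" "color_block_index G K v c = i"
  using assms by (auto simp: layer)

private lemma color_layer:
  assumes v: "v \<in> pverts G" and c: "c \<in> K v"
  shows "color_block_index G K v c \<in> {1..layer_count v}" "c \<in> layers (v, color_block_index G K v c)"
proof -
  show i: "color_block_index G K v c \<in> {1..layer_count v}"
    using layer_numbering[OF v] c unfolding block_numbering_def by blast
  show "c \<in> layers (v, color_block_index G K v c)"
    using c unfolding layer[OF v i] by simp
qed

private lemma same_layer:
  assumes "v \<in> pverts G" "i \<in> {1..layer_count v}" "c \<in> layers (v, i)" "d \<in> layers (v, i)"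
  shows "unseparated G K v c d"
proof -
  have "c \<in> K v" "d \<in> K v" "color_block_index G K v c = color_block_index G K v d"
    using layer_members[OF assms(1,2)] assms(3,4) by simp_all
  then show ?thesis using layer_numbering[OF assms(1)] unfolding block_numbering_def by blast
qed

private lemma layers_decrease:
  assumes v: "v \<in> pverts G" and ij: "i \<in> {1..layer_count v}" "j \<in> {1..layer_count v}" "i < j"
    and cd: "c \<in> layers (v, j)" "d \<in> layers (v, i)"
  shows "c < d"
proof (rule ccontr)
  assume "\<not> c < d"
  then have "descending c \<le> descending d" by simp
  then have "color_block_index G K v c \<le> color_block_index G K v d"
    using layer_numbering[OF v] layer_members(1)[OF v] ij cd unfolding block_numbering_def by blast
  then show False using layer_members(2)[OF v ij(2) cd(1)] layer_members(2)[OF v ij(1) cd(2)] ij(3)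
    by simp
qed

text \<open>If neither layer lies below the other, then each contains a colour above some colour of the
  other. In either order of the four colours, one of the two layers contains a pair separated by a
  colour of the other.\<close>

private lemma adjacent_layers_comparable:
  assumes vw: "(v, w) \<in> parcs G" and ij: "i \<in> {1..layer_count v}" "j \<in> {1..layer_count w}"
  shows "(\<forall>c\<in>layers (v, i). \<forall>d\<in>layers (w, j). c < d) \<or>
         (\<forall>c\<in>layers (v, i). \<forall>d\<in>layers (w, j). d < c)"
proof (rule ccontr)
  assume "\<not> ?thesis"
  then obtain a b c d where abcd: "a \<in> layers (v, i)" "b \<in> layers (w, j)" "b \<le> a"
      "c \<in> layers (v, i)" "d \<in> layers (w, j)" "c \<le> d"
    by (meson not_less)
  have vw': "v \<in> pverts G" "w \<in> pverts G" "(w, v) \<in> parcs G" using pair_graph_arcs[OF G vw] by auto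
  have mem: "a \<in> K v" "c \<in> K v" "b \<in> K w" "d \<in> K w"
    using layer_members(1) vw' ij abcd by blast+
  have "K v \<inter> K w = {}" using K vw by (auto simp: proper_set_colorings_def)
  then have "b < a" "c < d" "b \<noteq> c" using mem abcd by (auto simp: le_less)
  moreover have "unseparated G K v a c" "unseparated G K w b d"
    using same_layer vw' ij abcd by blast+
  ultimately show False
    using vw vw'(3) mem unfolding unseparated_def by (metis linorder_neqE_nat)
qed

private lemma Clan_arc_comparable:
  assumes "(x, y) \<in> parcs (Clan layer_count G)"
  shows "set_prec (layers x) (layers y) \<longleftrightarrow> \<not> set_prec (layers y) (layers x)"
proof -
  obtain v i w j where xy: "x = (v, i)" "y = (w, j)" by (meson surj_pair)
  have vw: "v \<in> pverts G" "i \<in> {1..layer_count v}" "w \<in> pverts G" "j \<in> {1..layer_count w}"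
      "(v, w) \<in> parcs G \<or> v = w \<and> i \<noteq> j"
    using assms unfolding xy Clan_arcs by auto
  then have S: "layers x \<in> SetP" "layers y \<in> SetP"
    using layers_SetP by (auto simp: PiE_iff layered_orientation_def xy)
  have "(\<forall>c\<in>layers x. \<forall>d\<in>layers y. c < d) \<or> (\<forall>c\<in>layers x. \<forall>d\<in>layers y. d < c)"
  proof (cases "(v, w) \<in> parcs G")
    case True
    then show ?thesis unfolding xy using adjacent_layers_comparable vw by blast
  next
    case False
    then have "w = v" "i < j \<or> j < i" using vw by auto
    then show ?thesis unfolding xy using layers_decrease vw by blast
  qed
  moreover obtain c d where "c \<in> layers x" "d \<in> layers y"
    using SetP_nonempty[OF S(1)] SetP_nonempty[OF S(2)] by blast
  ultimately show ?thesis
    unfolding set_prec_iff[OF S] set_prec_iff[OF S(2,1)] by (meson order_less_asym)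
qed

private lemma layered_orientation_arc:
  assumes "v \<in> pverts G" "i \<in> {1..layer_count v}" "w \<in> pverts G" "j \<in> {1..layer_count w}"
    and "(v, w) \<in> parcs G \<or> v = w \<and> i \<noteq> j"
    and "c \<in> layers (v, i)" "d \<in> layers (w, j)" "c < d"
  shows "((v, i), (w, j)) \<in> parcs layered_orientation"
proof -
  have arcs: "((v, i), (w, j)) \<in> parcs (Clan layer_count G)" using assms by (simp add: Clan_arcs)
  have S: "layers (v, i) \<in> SetP" "layers (w, j) \<in> SetP"
    using layers_SetP assms by (auto simp: PiE_iff layered_orientation_def)
  have "\<not> set_prec (layers (w, j)) (layers (v, i))"
    unfolding set_prec_iff[OF S(2,1)] using assms(6-) by (meson order_less_asym)
  then have "set_prec (layers (v, i)) (layers (w, j))" using Clan_arc_comparable[OF arcs] by simp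
  then show ?thesis using arcs by (simp add: layered_orientation_def)
qed

lemma layers_increasing: "layers \<in> increasing_set_maps layered_orientation"
  using layers_SetP by (auto simp: increasing_set_maps_def layered_orientation_def)

text \<open>Acyclicity holds because the least colour increases along arcs. Since consecutive layers of
  \<open>v\<close> are separated by a colour of some neighbour \<open>w\<close>, the layer of \<open>w\<close> containing it is the
  middle vertex of a second path.\<close>

lemma layered_orientation_multi_orientation: "multi_orientation layer_count G layered_orientation"
  unfolding multi_orientation_def
proof (intro conjI ballI)
  fix v assume v: "v \<in> pverts G"
  then have "K v \<in> SetP" using K by (auto simp: proper_set_colorings_def PiE_iff)
  then obtain c where "c \<in> K v" using SetP_nonempty by blast
  then have "color_block_index G K v c \<in> {1..layer_count v}" using color_layer(1)[OF v] by blast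
  then show "1 \<le> layer_count v" by simp
next
  have wf: "parcs layered_orientation \<subseteq> pverts layered_orientation \<times> pverts layered_orientation"
    by (auto simp: layered_orientation_def Clan_def)
  have sym: "(y, x) \<in> parcs (Clan layer_count G)" if "(x, y) \<in> parcs (Clan layer_count G)" for x y
    using that pair_graph_arcs(4)[OF G] by (cases x, cases y) (auto simp: Clan_arcs)
  have "parcs layered_orientation \<subseteq> measure (\<lambda>x. Min (layers x))"
  proof
    fix z assume "z \<in> parcs layered_orientation"
    then obtain x y where z: "z = (x, y)" "(x, y) \<in> parcs layered_orientation" by (cases z) auto
    then have "x \<in> pverts layered_orientation" "y \<in> pverts layered_orientation" using wf by auto
    then have "layers x \<in> SetP" "layers y \<in> SetP" using layers_SetP by (auto simp: PiE_iff)
    then have "Min (layers x) \<in> layers x" "Min (layers y) \<in> layers y" by (auto simp: SetP_def)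
    then show "z \<in> measure (\<lambda>x. Min (layers x))"
      using z increasing_set_maps_less[OF layers_increasing wf] by auto
  qed
  then have "acyclic (parcs layered_orientation)"
    using acyclic_subset wf_acyclic wf_measure by blast
  moreover have "(x, y) \<in> parcs layered_orientation \<longleftrightarrow> (y, x) \<notin> parcs layered_orientation"
    if "(x, y) \<in> parcs (Clan layer_count G)" for x y
    unfolding layered_orientation_def using Clan_arc_comparable[OF that] sym[OF that] that by simp
  ultimately show "acyclic_orientation (Clan layer_count G) layered_orientation"
    unfolding acyclic_orientation_def by (auto simp: layered_orientation_def Clan_verts)
next
  fix v i assume v: "v \<in> pverts G" and i: "i \<in> {1..layer_count v - 1}"
  let ?D = layered_orientation and ?x = "(v, i + 1)" and ?y = "(v, i)"
  have i': "i \<in> {1..layer_count v}" "i + 1 \<in> {1..layer_count v}" using i by auto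
  have SetP: "layers (w, j) \<in> SetP" if "w \<in> pverts G" "j \<in> {1..layer_count w}" for w j
    using layers_SetP that by (auto simp: PiE_iff layered_orientation_def)
  obtain c d where cd: "c \<in> layers ?x" "d \<in> layers ?y"
    using SetP_nonempty[OF SetP[OF v i'(1)]] SetP_nonempty[OF SetP[OF v i'(2)]] by blast
  have "c < d" using layers_decrease[OF v i' _ cd] by simp
  have "\<not> unseparated G K v c d"
    using layer_numbering[OF v] layer_members[OF v i'(2) cd(1)] layer_members[OF v i'(1) cd(2)]
    unfolding block_numbering_def by (metis Suc_eq_plus1 n_not_Suc_n)
  then obtain w e where e: "(v, w) \<in> parcs G" "e \<in> K w" "c < e" "e < d"
    using \<open>c < d\<close> unfolding unseparated_def by (meson order_less_asym order_less_trans)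
  have w: "w \<in> pverts G" "w \<noteq> v" "(w, v) \<in> parcs G" using pair_graph_arcs[OF G e(1)] by auto
  let ?z = "(w, color_block_index G K w e)"
  note j = color_layer[OF w(1) e(2)]
  have "(?x, ?y) \<in> parcs ?D"
    using layered_orientation_arc[OF v i'(2) v i'(1) _ cd] \<open>c < d\<close> by simp
  then have "[(?x, ?y)] \<in> directed_paths ?D ?x ?y"
    by (rule arc_directed_path) (use v i' in \<open>auto simp: layered_orientation_def\<close>)
  moreover have "[(?x, ?z), (?z, ?y)] \<in> directed_paths ?D ?x ?y"
  proof (rule two_arcs_directed_path)
    show "(?x, ?z) \<in> parcs ?D"
      using layered_orientation_arc[OF v i'(2) w(1) j(1) _ cd(1) j(2)] e by simp
    show "(?z, ?y) \<in> parcs ?D"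
      using layered_orientation_arc[OF w(1) j(1) v i'(1) _ j(2) cd(2)] e w by simp
  qed (use v i' w in \<open>auto simp: layered_orientation_def\<close>)
  ultimately show "\<exists>p \<in> directed_paths ?D ?x ?y. \<exists>q \<in> directed_paths ?D ?x ?y. p \<noteq> q"
    by (intro bexI[of _ "[(?x, ?y)]"] bexI[of _ "[(?x, ?z), (?z, ?y)]"]) auto
qed

lemma merge_layers: "merge (pverts layered_orientation) fst (pverts G) layers = K"
proof (rule extensionalityI)
  show "merge (pverts layered_orientation) fst (pverts G) layers \<in> extensional (pverts G)"
    by (simp add: merge_def)
  show "K \<in> extensional (pverts G)"
    using K by (auto simp: proper_set_colorings_def PiE_iff)
  fix v assume v: "v \<in> pverts G"
  show "merge (pverts layered_orientation) fst (pverts G) layers v = K v"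
  proof (rule set_eqI)
    fix c
    have "c \<in> merge (pverts layered_orientation) fst (pverts G) layers v \<longleftrightarrow>
        (\<exists>i\<in>{1..layer_count v}. c \<in> layers (v, i))"
      using v by (auto simp: mem_merge layered_orientation_def)
    also have "\<dots> \<longleftrightarrow> c \<in> K v"
      using layer_members(1)[OF v] color_layer[OF v] by blast
    finally show "c \<in> merge (pverts layered_orientation) fst (pverts G) layers v \<longleftrightarrow> c \<in> K v" .
  qed
qed

end

theorem Kromatic_sum_Gamma_bar:
  assumes G: "pair_graph G"
  shows "has_formal_sum Gamma_bar (mAO G) (Kromatic G)"
proof -
  let ?\<phi> = "\<lambda>D. merge (pverts D) fst (pverts G)"
  have "has_formal_sum (\<lambda>D. formal_sum (xpow (pverts D)) (increasing_set_maps D)) (mAO G)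
      (formal_sum (xpow (pverts G)) (proper_set_colorings G))"
  proof (rule has_formal_sum_xpow_by_bijection)
    show fin: "finite (pverts G)" using G by (rule pair_graph_finite)
    show "proper_set_colorings G \<subseteq> pverts G \<rightarrow>\<^sub>E SetP" by (auto simp: proper_set_colorings_def)
    show "bij_betw (\<lambda>(D, \<kappa>). ?\<phi> D \<kappa>) (SIGMA D:mAO G. increasing_set_maps D) (proper_set_colorings G)"
      unfolding bij_betw_def
    proof
      show "inj_on (\<lambda>(D, \<kappa>). ?\<phi> D \<kappa>) (SIGMA D:mAO G. increasing_set_maps D)"
      proof (rule inj_onI, clarify)
        fix D \<kappa> D' \<kappa>'
        assume "D \<in> mAO G" "D' \<in> mAO G"
          and k: "\<kappa> \<in> increasing_set_maps D" "\<kappa>' \<in> increasing_set_maps D'" "?\<phi> D \<kappa> = ?\<phi> D' \<kappa>'"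
        then obtain \<alpha> \<alpha>' where "multi_orientation \<alpha> G D" "multi_orientation \<alpha>' G D'"
          unfolding mAO_iff by blast
        then show "D = D' \<and> \<kappa> = \<kappa>'" using multi_orientation_determined[OF G] k by metis
      qed
      show "(\<lambda>(D, \<kappa>). ?\<phi> D \<kappa>) ` (SIGMA D:mAO G. increasing_set_maps D) = proper_set_colorings G"
      proof
        show "(\<lambda>(D, \<kappa>). ?\<phi> D \<kappa>) ` (SIGMA D:mAO G. increasing_set_maps D) \<subseteq> proper_set_colorings G"
          using multi_orientation_merge_proper[OF G] by (auto simp: mAO_iff)
        show "proper_set_colorings G \<subseteq> (\<lambda>(D, \<kappa>). ?\<phi> D \<kappa>) ` (SIGMA D:mAO G. increasing_set_maps D)"
        proof
          fix K assume K: "K \<in> proper_set_colorings G"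
          have "(layered_orientation G K, layers G K) \<in> (SIGMA D:mAO G. increasing_set_maps D)"
            using layered_orientation_multi_orientation[OF G K] layers_increasing[OF G K]
            by (auto simp: mAO_iff)
          then show "K \<in> (\<lambda>(D, \<kappa>). ?\<phi> D \<kappa>) ` (SIGMA D:mAO G. increasing_set_maps D)"
            using merge_layers[OF G K] by force
        qed
      qed
    qed
    fix D \<kappa> assume "D \<in> mAO G" and \<kappa>: "\<kappa> \<in> increasing_set_maps D"
    then obtain \<alpha> where D: "multi_orientation \<alpha> G D" by (auto simp: mAO_iff)
    show "content (pverts G) (?\<phi> D \<kappa>) = content (pverts D) \<kappa>"
    proof (rule content_merge)
      show "finite (pverts D)" "fst ` pverts D \<subseteq> pverts G"
        using fin by (auto simp: multi_orientation_verts[OF D])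
      show "\<kappa> \<in> pverts D \<rightarrow>\<^sub>E SetP" using \<kappa> by (simp add: increasing_set_maps_def)
    qed (use fin multi_orientation_layers_disjoint[OF G D \<kappa>] in auto)
  qed
  then show ?thesis
    by (simp add: Gamma_bar_def[abs_def] Kromatic_def increasing_set_maps_def proper_set_colorings_def)
qed

section \<open>Words and multifundamental quasisymmetric functions\<close>

text \<open>Linear extensions in which a vertex may recur. It may not recur at once, because two equal
  neighbouring letters could be contracted to one letter carrying the union of their sets.\<close>

definition linear_multiextensions :: "'v pair_pre_digraph \<Rightarrow> (nat \<times> (nat \<Rightarrow> 'v)) set" where
  "linear_multiextensions D = {(n, w). w \<in> {1..n} \<rightarrow>\<^sub>E pverts D \<and> w ` {1..n} = pverts D \<and>
     (\<forall>i\<in>{1..n-1}. w i \<noteq> w (i+1)) \<and>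
     (\<forall>i\<in>{1..n}. \<forall>j\<in>{1..n}. (w i, w j) \<in> parcs D \<longrightarrow> i < j)}"

definition descents :: "('v \<Rightarrow> nat) \<Rightarrow> nat \<Rightarrow> (nat \<Rightarrow> 'v) \<Rightarrow> nat set" where
  "descents l n w = {i \<in> {1..n-1}. l (w (i+1)) < l (w i)}"

definition Lbar_maps :: "nat \<Rightarrow> nat set \<Rightarrow> (nat \<Rightarrow> nat set) set" where
  "Lbar_maps n S = {A \<in> {1..n} \<rightarrow>\<^sub>E SetP.
        (\<forall>i \<in> {1..n-1} - S. set_preceq (A i) (A (i+1))) \<and>
        (\<forall>i \<in> S. set_prec (A i) (A (i+1)))}"

definition occurrences :: "'v set \<Rightarrow> ('v \<Rightarrow> nat set) \<Rightarrow> (nat \<times> 'v) set" where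
  "occurrences V \<kappa> = {(c, v). v \<in> V \<and> c \<in> \<kappa> v}"

text \<open>Keys are compared lexicographically. The word of a set-valued map consists of the vertices met
  when its occurrences are read in this order, with maximal runs of the same vertex contracted to one
  letter.\<close>

definition reading_key :: "('v \<Rightarrow> nat) \<Rightarrow> nat \<times> 'v \<Rightarrow> nat \<times> nat" where
  "reading_key l p = (fst p, l (snd p))"

definition same_run :: "('v \<Rightarrow> nat) \<Rightarrow> (nat \<times> 'v) set \<Rightarrow> nat \<times> 'v \<Rightarrow> nat \<times> 'v \<Rightarrow> bool" where
  "same_run l P p q \<longleftrightarrow> snd p = snd q \<and>
     (\<forall>x\<in>P. reading_key l x \<in> {reading_key l p..reading_key l q} \<union>
        {reading_key l q..reading_key l p} \<longrightarrow> snd x = snd p)"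

abbreviation run_index :: "('v \<Rightarrow> nat) \<Rightarrow> (nat \<times> 'v) set \<Rightarrow> nat \<times> 'v \<Rightarrow> nat" where
  "run_index l P \<equiv> block_index (reading_key l) P (same_run l P)"

lemma finite_occurrences:
  assumes "finite V" "\<kappa> \<in> V \<rightarrow>\<^sub>E SetP"
  shows "finite (occurrences V \<kappa>)"
proof (rule finite_subset)
  show "occurrences V \<kappa> \<subseteq> (\<Union>v\<in>V. \<kappa> v) \<times> V" by (auto simp: occurrences_def)
  show "finite ((\<Union>v\<in>V. \<kappa> v) \<times> V)" using assms by (auto simp: PiE_iff SetP_def)
qed

lemma inj_on_reading_key: "inj_on l V \<Longrightarrow> inj_on (reading_key l) (occurrences V \<kappa>)"
  by (auto simp: inj_on_def reading_key_def occurrences_def)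

text \<open>Being in the same run is transitive because an element between the ends of two overlapping or
  adjoining ranges lies in one of the ranges.\<close>

lemma block_numbering_run_index:
  assumes V: "finite V" "\<kappa> \<in> V \<rightarrow>\<^sub>E SetP" and l: "inj_on l V"
  obtains n where "block_numbering (reading_key l) (occurrences V \<kappa>)
    (same_run l (occurrences V \<kappa>)) n (run_index l (occurrences V \<kappa>))"
proof (rule block_numbering_exists[where key = "reading_key l" and P = "occurrences V \<kappa>"
      and R = "same_run l (occurrences V \<kappa>)"])
  let ?P = "occurrences V \<kappa>" and ?k = "reading_key l"
  show "finite ?P" using finite_occurrences[OF V] .
  show inj: "inj_on ?k ?P" using inj_on_reading_key[OF l] .
  show "same_run l ?P p p" if "p \<in> ?P" for p
    using that inj by (auto simp: same_run_def dest: inj_onD)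
  show "same_run l ?P q p" if "same_run l ?P p q" for p q
    using that by (auto simp: same_run_def)
  show "same_run l ?P p x" if pq: "same_run l ?P p q" and qx: "same_run l ?P q x" for p q x
    unfolding same_run_def
  proof (intro conjI ballI impI)
    show "snd p = snd x" using pq qx by (simp add: same_run_def)
    fix y assume y: "y \<in> ?P" "?k y \<in> {?k p..?k x} \<union> {?k x..?k p}"
    then consider "?k y \<in> {?k p..?k q} \<union> {?k q..?k p}" | "?k y \<in> {?k q..?k x} \<union> {?k x..?k q}"
      using linear[of "?k y" "?k q"] by auto
    then show "snd y = snd p"
    proof cases
      case 1
      then show ?thesis using pq y(1) unfolding same_run_def by blast
    next
      case 2
      then have "snd y = snd q" using qx y(1) unfolding same_run_def by blast
      then show ?thesis using pq by (simp add: same_run_def)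
    qed
  qed
  show "same_run l ?P p x"
    if "p \<in> ?P" "x \<in> ?P" "q \<in> ?P" "?k p \<le> ?k x" "?k x \<le> ?k q" "same_run l ?P p q" for p x q
  proof -
    have s: "snd y = snd p" if "y \<in> ?P" "?k p \<le> ?k y" "?k y \<le> ?k q" for y
      using \<open>same_run l ?P p q\<close> that by (auto simp: same_run_def)
    have "snd y = snd p" if "y \<in> ?P" "?k y \<in> {?k p..?k x} \<union> {?k x..?k p}" for y
    proof (rule s[OF that(1)])
      show "?k p \<le> ?k y" "?k y \<le> ?k q"
        using that(2) \<open>?k p \<le> ?k x\<close> \<open>?k x \<le> ?k q\<close> by (auto intro: order_trans)
    qed
    then show ?thesis using s[OF that(2,4,5)] unfolding same_run_def by simp
  qed
qed (rule that)

context
  fixes D :: "'v pair_pre_digraph" and l :: "'v \<Rightarrow> nat"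
  assumes fin: "finite (pverts D)" and wf: "parcs D \<subseteq> pverts D \<times> pverts D"
    and inj: "inj_on l (pverts D)"
    and decr: "\<And>u v. (u, v) \<in> parcs D \<Longrightarrow> l v < l u"
begin

context
  fixes n w A
  assumes nw: "(n, w) \<in> linear_multiextensions D" and A: "A \<in> Lbar_maps n (descents l n w)"
begin

private lemma w_verts: "i \<in> {1..n} \<Longrightarrow> w i \<in> pverts D"
  using nw by (auto simp: linear_multiextensions_def)

private lemma A_SetP: "i \<in> {1..n} \<Longrightarrow> A i \<in> SetP"
  using A by (auto simp: Lbar_maps_def PiE_iff)

text \<open>At a descent the colours increase strictly. At any other step they increase weakly and the label
  increases strictly, because consecutive letters differ and the labelling is injective. In both cases
  the reading order increases.\<close>

private lemma keys_increase:
  assumes "1 \<le> i" "i < k" "k \<le> n" "c \<in> A i" "d \<in> A k"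
  shows "(c, l (w i)) < (d, l (w k))"
proof -
  have consecutive: "(a, l (w j)) < (b, l (w (Suc j)))"
    if j: "1 \<le> j" "Suc j \<le> n" and ab: "a \<in> A j" "b \<in> A (Suc j)" for j a b
  proof -
    have j': "j \<in> {1..n}" "Suc j \<in> {1..n}" "j \<in> {1..n-1}" using j by auto
    note S = A_SetP[OF j'(1)] A_SetP[OF j'(2)]
    show ?thesis
    proof (cases "j \<in> descents l n w")
      case True
      then have "set_prec (A j) (A (Suc j))" using A by (auto simp: Lbar_maps_def)
      then have "a < b" using ab set_prec_iff[OF S] by blast
      then show ?thesis by simp
    next
      case False
      then have "set_preceq (A j) (A (Suc j))" using A j' by (auto simp: Lbar_maps_def)
      then have "a \<le> b" using ab set_preceq_iff[OF S] by blast
      moreover have "w j \<noteq> w (Suc j)" using nw j'(3) by (auto simp: linear_multiextensions_def)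
      then have "l (w j) \<noteq> l (w (Suc j))"
        using inj w_verts[OF j'(1)] w_verts[OF j'(2)] by (auto dest: inj_onD)
      then have "l (w j) < l (w (Suc j))" using False j' by (auto simp: descents_def)
      ultimately show ?thesis by auto
    qed
  qed
  have "Suc i \<le> k" using assms by simp
  then show ?thesis using \<open>k \<le> n\<close> \<open>d \<in> A k\<close>
  proof (induction k arbitrary: d rule: dec_induct)
    case base
    then show ?case using consecutive assms by blast
  next
    case (step k)
    then obtain b where b: "b \<in> A k" using SetP_nonempty[OF A_SetP[of k]] by auto
    then have "(c, l (w i)) < (b, l (w k))" using step by simp
    also have "\<dots> < (d, l (w (Suc k)))" using consecutive step b assms by simp
    finally show ?case .
  qed
qed

text \<open>A common colour would have the same reading key at both positions.\<close>

lemma multiextension_blocks_disjoint: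
  assumes "i \<in> {1..n}" "k \<in> {1..n}" "w i = w k" "i \<noteq> k"
  shows "A i \<inter> A k = {}"
proof -
  have "c \<noteq> d" if "c \<in> A i" "d \<in> A k" for c d
  proof (cases "i < k")
    case True
    then show ?thesis using keys_increase[of i k c d] that assms by auto
  next
    case False
    then show ?thesis using keys_increase[of k i d c] that assms by auto
  qed
  then show ?thesis by blast
qed

abbreviation (input) "word_merge \<equiv> merge {1..n} w (pverts D) A"

private lemma mem_word_merge:
  "v \<in> pverts D \<Longrightarrow> c \<in> word_merge v \<longleftrightarrow> (\<exists>i\<in>{1..n}. w i = v \<and> c \<in> A i)"
  by (rule mem_merge)

text \<open>Labels decrease along arcs, so the reading order can increase from the tail of an arc to its
  head only if the colour increases strictly.\<close>

lemma word_merge_increasing: "word_merge \<in> increasing_set_maps D"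
proof -
  have "w ` {1..n} = pverts D" "A \<in> {1..n} \<rightarrow>\<^sub>E SetP"
    using nw A by (auto simp: linear_multiextensions_def Lbar_maps_def)
  then have m: "word_merge \<in> pverts D \<rightarrow>\<^sub>E SetP" by (intro merge_SetP) auto
  moreover have "set_prec (word_merge u) (word_merge v)" if uv: "(u, v) \<in> parcs D" for u v
  proof -
    have V: "u \<in> pverts D" "v \<in> pverts D" using wf uv by auto
    have "c < d" if cd: "c \<in> word_merge u" "d \<in> word_merge v" for c d
    proof -
      obtain i k where ik: "i \<in> {1..n}" "w i = u" "c \<in> A i" "k \<in> {1..n}" "w k = v" "d \<in> A k"
        using cd unfolding mem_word_merge[OF V(1)] mem_word_merge[OF V(2)] by blast
      then have "i < k" using nw uv by (auto simp: linear_multiextensions_def)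
      then have "(c, l u) < (d, l v)" using keys_increase[of i k c d] ik by auto
      then show ?thesis using decr[OF uv] by auto
    qed
    moreover have "word_merge u \<in> SetP" "word_merge v \<in> SetP" using m V by (auto simp: PiE_iff)
    ultimately show ?thesis by (simp add: set_prec_iff)
  qed
  ultimately show ?thesis unfolding increasing_set_maps_def by auto
qed

text \<open>Positions in the word number the runs: pieces come in reading order, each uses one vertex, and
  consecutive pieces use different vertices. So the runs of the merged map are exactly the pieces.\<close>

lemma word_merge_run_index:
  defines "P \<equiv> occurrences (pverts D) word_merge"
  shows "run_index l P ` P = {1..n}"
    and "i \<in> {1..n} \<Longrightarrow> c \<in> A i \<Longrightarrow> (c, w i) \<in> P \<and> run_index l P (c, w i) = i"
    and "p \<in> P \<Longrightarrow> \<exists>i\<in>{1..n}. snd p = w i \<and> fst p \<in> A i"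
proof -
  define r where "r p = (THE i. i \<in> {1..n} \<and> w i = snd p \<and> fst p \<in> A i)" for p
  have P: "(c, v) \<in> P \<longleftrightarrow> (\<exists>i\<in>{1..n}. w i = v \<and> c \<in> A i)" for c v
    unfolding P_def occurrences_def mem_Collect_eq prod.case using mem_word_merge w_verts by metis
  have r: "r (c, w i) = i" if "i \<in> {1..n}" "c \<in> A i" for c i
    unfolding r_def
  proof (rule the_equality)
    fix k assume "k \<in> {1..n} \<and> w k = snd (c, w i) \<and> fst (c, w i) \<in> A k"
    then show "k = i" using that multiextension_blocks_disjoint[of k i] by auto
  qed (use that in auto)
  have rP: "r p \<in> {1..n}" "w (r p) = snd p" "fst p \<in> A (r p)" if p: "p \<in> P" for p
  proof -
    obtain i where i: "i \<in> {1..n}" "w i = snd p" "fst p \<in> A i" using p P[of "fst p" "snd p"] by auto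
    then have "r p = i" using r[of i "fst p"] by simp
    then show "r p \<in> {1..n}" "w (r p) = snd p" "fst p \<in> A (r p)" using i by simp_all
  qed
  have less: "reading_key l p < reading_key l q" if "p \<in> P" "q \<in> P" "r p < r q" for p q
    using keys_increase[of "r p" "r q" "fst p" "fst q"] rP[OF that(1)] rP[OF that(2)] that(3)
    by (auto simp: reading_key_def)
  have mono: "r p \<le> r q" if "p \<in> P" "q \<in> P" "reading_key l p \<le> reading_key l q" for p q
    using less[OF that(2,1)] that(3) by (meson leD leI)
  have diff: "\<exists>x\<in>P. snd x \<noteq> snd p \<and> reading_key l p \<le> reading_key l x \<and> reading_key l x \<le> reading_key l q"
    if pq: "p \<in> P" "q \<in> P" "r p < r q" for p q
  proof (cases "r q = Suc (r p)")
    case True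
    have "r p \<in> {1..n-1}" using rP[OF pq(1)] rP[OF pq(2)] True by auto
    then have "w (r p) \<noteq> w (r q)" using nw True by (auto simp: linear_multiextensions_def)
    then have "snd q \<noteq> snd p" using rP[OF pq(1)] rP[OF pq(2)] by simp
    then show ?thesis using pq less[OF pq] by (intro bexI[of _ q]) auto
  next
    case False
    have i: "Suc (r p) \<in> {1..n}" "r p \<in> {1..n-1}" using rP[OF pq(1)] rP[OF pq(2)] pq(3) False by auto
    then obtain c where c: "c \<in> A (Suc (r p))" using SetP_nonempty[OF A_SetP] by blast
    let ?x = "(c, w (Suc (r p)))"
    have x: "?x \<in> P" "r ?x = Suc (r p)" using r[OF i(1) c] P c i by auto
    have "w (r p) \<noteq> w (Suc (r p))" using nw i by (auto simp: linear_multiextensions_def)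
    then have "snd ?x \<noteq> snd p" using rP[OF pq(1)] by simp
    moreover have "reading_key l p < reading_key l ?x" "reading_key l ?x < reading_key l q"
      using less[OF pq(1) x(1)] less[OF x(1) pq(2)] x(2) False pq(3) by auto
    ultimately show ?thesis using x by (intro bexI[of _ ?x]) auto
  qed
  have "block_numbering (reading_key l) P (same_run l P) n r"
    unfolding block_numbering_def
  proof (intro conjI ballI impI)
    show "r ` P = {1..n}"
    proof
      show "r ` P \<subseteq> {1..n}" using rP by blast
      show "{1..n} \<subseteq> r ` P"
      proof
        fix i assume i: "i \<in> {1..n}"
        then obtain c where c: "c \<in> A i" using SetP_nonempty[OF A_SetP] by blast
        then have "(c, w i) \<in> P" using P i by blast
        then show "i \<in> r ` P" using r[OF i c] by force
      qed
    qed
  next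
    fix p q assume "p \<in> P" "q \<in> P" "reading_key l p \<le> reading_key l q"
    then show "r p \<le> r q" by (rule mono)
  next
    fix p q assume pq: "p \<in> P" "q \<in> P"
    show "r p = r q \<longleftrightarrow> same_run l P p q"
    proof
      assume eq: "r p = r q"
      have "snd x = snd p" if x: "x \<in> P" "reading_key l x \<in> {reading_key l p..reading_key l q} \<union>
        {reading_key l q..reading_key l p}" for x
      proof -
        have "r x = r p" using x(2) mono[OF pq(1) x(1)] mono[OF x(1) pq(2)]
            mono[OF pq(2) x(1)] mono[OF x(1) pq(1)] eq by auto
        then show ?thesis using rP[OF x(1)] rP[OF pq(1)] by simp
      qed
      moreover have "snd p = snd q" using rP[OF pq(1)] rP[OF pq(2)] eq by simp
      ultimately show "same_run l P p q" unfolding same_run_def by blast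
    next
      assume R: "same_run l P p q"
      have "\<not> r p < r q"
      proof
        assume "r p < r q"
        then obtain x where "x \<in> P" "snd x \<noteq> snd p" "reading_key l p \<le> reading_key l x"
          "reading_key l x \<le> reading_key l q" using diff[OF pq] by blast
        then show False using R unfolding same_run_def by simp
      qed
      moreover have "\<not> r q < r p"
      proof
        assume "r q < r p"
        then obtain x where "x \<in> P" "snd x \<noteq> snd q" "reading_key l q \<le> reading_key l x"
          "reading_key l x \<le> reading_key l p" using diff[OF pq(2,1)] by blast
        then show False using R unfolding same_run_def by simp
      qed
      ultimately show "r p = r q" by simp
    qed
  qed
  moreover have "finite P" unfolding P_def
    using fin word_merge_increasing by (intro finite_occurrences) (auto simp: increasing_set_maps_def)
  moreover have "inj_on (reading_key l) P" unfolding P_def by (rule inj_on_reading_key[OF inj])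
  ultimately have idx: "run_index l P p = r p" if "p \<in> P" for p
    using block_numbering_unique[of P "reading_key l" _ _ r p] that by simp
  have "run_index l P ` P = r ` P" using idx by (rule image_cong[OF refl])
  then show "run_index l P ` P = {1..n}"
    using \<open>block_numbering _ _ _ _ r\<close> by (simp add: block_numbering_def)
  show "i \<in> {1..n} \<Longrightarrow> c \<in> A i \<Longrightarrow> (c, w i) \<in> P \<and> run_index l P (c, w i) = i"
    using idx[of "(c, w i)"] r[of i c] P[of c "w i"] by auto
  show "p \<in> P \<Longrightarrow> \<exists>i\<in>{1..n}. snd p = w i \<and> fst p \<in> A i"
    using rP by metis
qed

end

lemma word_merge_determined:
  assumes nw: "(n, w) \<in> linear_multiextensions D" "A \<in> Lbar_maps n (descents l n w)"
    and nw': "(n', w') \<in> linear_multiextensions D" "A' \<in> Lbar_maps n' (descents l n' w')"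
    and eq: "merge {1..n} w (pverts D) A = merge {1..n'} w' (pverts D) A'"
  shows "n = n' \<and> w = w' \<and> A = A'"
proof -
  let ?r = "run_index l (occurrences (pverts D) (merge {1..n} w (pverts D) A))"
  note W = word_merge_run_index[OF nw] and W' = word_merge_run_index[OF nw', folded eq]
  have "{1..n} = {1..n'}" using W(1) W'(1) by (rule trans[OF sym])
  then have "card {1..n} = card {1..n'}" by (rule arg_cong)
  then have n: "n = n'" by simp
  have one: "w i = w' i \<and> c \<in> A' i" if i: "i \<in> {1..n}" "c \<in> A i" for i c
  proof -
    obtain k where k: "k \<in> {1..n'}" "w i = w' k" "c \<in> A' k"
      using W'(3)[of "(c, w i)"] W(2)[OF i] by auto
    have "k = i" using W'(2)[OF k(1,3)] W(2)[OF i] k(2) by simp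
    then show ?thesis using k by simp
  qed
  have two: "c \<in> A i" if i: "i \<in> {1..n'}" "c \<in> A' i" for i c
  proof -
    obtain k where k: "k \<in> {1..n}" "w' i = w k" "c \<in> A k"
      using W(3)[of "(c, w' i)"] W'(2)[OF i] by auto
    have "k = i" using W(2)[OF k(1,3)] W'(2)[OF i] k(2) by simp
    then show ?thesis using k by simp
  qed
  have SetP: "A i \<in> SetP" if "i \<in> {1..n}" for i
    using nw(2) that by (auto simp: Lbar_maps_def PiE_iff)
  have "w = w'"
  proof (rule PiE_ext)
    show "w \<in> {1..n} \<rightarrow>\<^sub>E pverts D" "w' \<in> {1..n} \<rightarrow>\<^sub>E pverts D"
      using nw(1) nw'(1) n by (auto simp: linear_multiextensions_def)
    show "w i = w' i" if "i \<in> {1..n}" for i using one[OF that] SetP_nonempty[OF SetP[OF that]] by blast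
  qed
  moreover have "A = A'"
  proof (rule PiE_ext)
    show "A \<in> {1..n} \<rightarrow>\<^sub>E SetP" "A' \<in> {1..n} \<rightarrow>\<^sub>E SetP"
      using nw(2) nw'(2) n by (auto simp: Lbar_maps_def)
    show "A i = A' i" if "i \<in> {1..n}" for i using one[OF that] two[of i] that n by blast
  qed
  ultimately show ?thesis using n by blast
qed

text \<open>The letters are the vertices of the successive runs and the sets are the colours in them. At a
  descent the label drops, so the reading order forces the colour to rise strictly. An arc from
  \<open>u\<close> to \<open>v\<close> puts all colours of \<open>u\<close> below those of \<open>v\<close>, so all runs of \<open>u\<close> come first.\<close>

lemma word_merge_exists:
  assumes \<kappa>: "\<kappa> \<in> increasing_set_maps D"
  obtains n w A where "(n, w) \<in> linear_multiextensions D" "A \<in> Lbar_maps n (descents l n w)"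
    "merge {1..n} w (pverts D) A = \<kappa>"
proof -
  define P where "P = occurrences (pverts D) \<kappa>"
  let ?r = "run_index l P" and ?k = "reading_key l"
  have \<kappa>E: "\<kappa> \<in> pverts D \<rightarrow>\<^sub>E SetP" using \<kappa> by (simp add: increasing_set_maps_def)
  have memP: "(c, v) \<in> P \<longleftrightarrow> v \<in> pverts D \<and> c \<in> \<kappa> v" for c v by (simp add: P_def occurrences_def)
  obtain n where "block_numbering ?k P (same_run l P) n ?r"
    using block_numbering_run_index[OF fin \<kappa>E inj] unfolding P_def by blast
  then have img: "?r ` P = {1..n}"
    and mono: "\<And>p q. p \<in> P \<Longrightarrow> q \<in> P \<Longrightarrow> ?k p \<le> ?k q \<Longrightarrow> ?r p \<le> ?r q"
    and ker: "\<And>p q. p \<in> P \<Longrightarrow> q \<in> P \<Longrightarrow> ?r p = ?r q \<longleftrightarrow> same_run l P p q"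
    by (simp_all add: block_numbering_def)
  have less: "?k p < ?k q" if "p \<in> P" "q \<in> P" "?r p < ?r q" for p q
    using mono[OF that(2,1)] that(3) by (meson leD not_le_imp_less)
  define w where "w = (\<lambda>i\<in>{1..n}. snd (SOME p. p \<in> P \<and> ?r p = i))"
  define A where "A = (\<lambda>i\<in>{1..n}. {c. \<exists>v. (c, v) \<in> P \<and> ?r (c, v) = i})"
  have w: "w (?r p) = snd p" if p: "p \<in> P" for p
  proof -
    have i: "?r p \<in> {1..n}" using img p by blast
    define q where "q = (SOME q. q \<in> P \<and> ?r q = ?r p)"
    have "q \<in> P \<and> ?r q = ?r p" unfolding q_def by (rule someI[of _ p]) (use p in simp)
    then have "same_run l P q p" using ker p by blast
    then have "snd q = snd p" by (simp add: same_run_def)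
    then show ?thesis using i by (simp add: w_def q_def)
  qed
  have A: "c \<in> A i \<longleftrightarrow> (c, w i) \<in> P \<and> ?r (c, w i) = i" if i: "i \<in> {1..n}" for c i
  proof
    assume "c \<in> A i"
    then obtain v where "(c, v) \<in> P" "?r (c, v) = i" using i by (auto simp: A_def)
    then show "(c, w i) \<in> P \<and> ?r (c, w i) = i" using w[of "(c, v)"] by auto
  qed (use i in \<open>auto simp: A_def\<close>)
  have ne: "\<exists>c. c \<in> A i" if i: "i \<in> {1..n}" for i
  proof -
    obtain p where "p \<in> P" "?r p = i" using img i by (metis imageE)
    then have "fst p \<in> A i" using A[OF i] w[of p] by auto
    then show ?thesis by blast
  qed
  have wV: "w i \<in> pverts D" if i: "i \<in> {1..n}" for i
    using ne[OF i] A[OF i] memP by blast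
  have "(n, w) \<in> linear_multiextensions D"
    unfolding linear_multiextensions_def
  proof (clarify, intro conjI ballI impI)
    show "w \<in> {1..n} \<rightarrow>\<^sub>E pverts D" using wV by (auto simp: w_def)
    show "w ` {1..n} = pverts D"
    proof
      show "w ` {1..n} \<subseteq> pverts D" using wV by blast
      show "pverts D \<subseteq> w ` {1..n}"
      proof
        fix v assume v: "v \<in> pverts D"
        then obtain c where "c \<in> \<kappa> v" using \<kappa>E SetP_nonempty by (auto simp: PiE_iff)
        then have p: "(c, v) \<in> P" using memP v by simp
        then have "?r (c, v) \<in> {1..n}" "w (?r (c, v)) = v" using img w[OF p] by auto
        then show "v \<in> w ` {1..n}" by force
      qed
    qed
  next
    fix i assume i: "i \<in> {1..n-1}"
    then have i': "i \<in> {1..n}" "i + 1 \<in> {1..n}" by auto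
    obtain c d where "c \<in> A i" "d \<in> A (i + 1)" using ne[OF i'(1)] ne[OF i'(2)] by blast
    then have p: "(c, w i) \<in> P" "?r (c, w i) = i" and q: "(d, w (i + 1)) \<in> P" "?r (d, w (i + 1)) = i + 1"
      using A[OF i'(1)] A[OF i'(2)] by auto
    let ?p = "(c, w i)" and ?q = "(d, w (i + 1))"
    show "w i \<noteq> w (i + 1)"
    proof
      assume eq: "w i = w (i + 1)"
      have pq: "?k ?p < ?k ?q" using less[OF p(1) q(1)] p(2) q(2) by simp
      have "snd x = snd ?p" if x: "x \<in> P" "?k x \<in> {?k ?p..?k ?q} \<union> {?k ?q..?k ?p}" for x
      proof -
        have "?k ?p \<le> ?k x" "?k x \<le> ?k ?q" using x(2) pq by auto
        then have "i \<le> ?r x" "?r x \<le> i + 1"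
          using mono[OF p(1) x(1)] mono[OF x(1) q(1)] p(2) q(2) by simp_all
        then have "?r x = i \<or> ?r x = i + 1" by linarith
        then show ?thesis using w[OF x(1)] eq by auto
      qed
      moreover have "snd ?p = snd ?q" using eq by simp
      ultimately have "same_run l P ?p ?q" unfolding same_run_def by blast
      then show False using ker[OF p(1) q(1)] p(2) q(2) by simp
    qed
  next
    fix i j assume ij: "i \<in> {1..n}" "j \<in> {1..n}" and e: "(w i, w j) \<in> parcs D"
    obtain c d where "c \<in> A i" "d \<in> A j" using ne[OF ij(1)] ne[OF ij(2)] by blast
    then have p: "(c, w i) \<in> P" "?r (c, w i) = i" and q: "(d, w j) \<in> P" "?r (d, w j) = j"
      using A[OF ij(1)] A[OF ij(2)] by auto
    have "c < d" using increasing_set_maps_less[OF \<kappa> wf e] p q memP by blast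
    then have "?k (c, w i) \<le> ?k (d, w j)" by (simp add: reading_key_def)
    then have "i \<le> j" using mono[OF p(1) q(1)] p(2) q(2) by simp
    moreover have "i \<noteq> j" using decr[OF e] by auto
    ultimately show "i < j" by simp
  qed
  moreover have "A \<in> Lbar_maps n (descents l n w)"
  proof -
    have AE: "A i \<in> SetP" if i: "i \<in> {1..n}" for i
    proof (rule SetP_subset)
      show "\<kappa> (w i) \<in> SetP" using \<kappa>E wV[OF i] by (auto simp: PiE_iff)
      show "A i \<subseteq> \<kappa> (w i)" using A[OF i] memP by blast
      show "A i \<noteq> {}" using ne[OF i] by blast
    qed
    have step: "(c, l (w i)) < (d, l (w (i + 1)))"
      if i: "i \<in> {1..n-1}" and cd: "c \<in> A i" "d \<in> A (i + 1)" for i c d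
    proof -
      have i': "i \<in> {1..n}" "i + 1 \<in> {1..n}" using i by auto
      then show ?thesis using less[of "(c, w i)" "(d, w (i + 1))"] A[OF i'(1)] A[OF i'(2)] cd
        by (auto simp: reading_key_def)
    qed
    show ?thesis unfolding Lbar_maps_def
    proof (clarify, intro conjI ballI)
      show "A \<in> {1..n} \<rightarrow>\<^sub>E SetP" using AE by (auto simp: A_def)
    next
      fix i assume i: "i \<in> {1..n-1} - descents l n w"
      then have "i \<in> {1..n}" "i + 1 \<in> {1..n}" by auto
      then show "set_preceq (A i) (A (i + 1))"
        using step[of i] i by (fastforce simp: set_preceq_iff[OF AE AE])
    next
      fix i assume i: "i \<in> descents l n w"
      then have "i \<in> {1..n}" "i + 1 \<in> {1..n}" "i \<in> {1..n-1}" by (auto simp: descents_def)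
      then show "set_prec (A i) (A (i + 1))"
        using step[of i] i by (fastforce simp: set_prec_iff[OF AE AE] descents_def)
    qed
  qed
  moreover have "merge {1..n} w (pverts D) A = \<kappa>"
  proof (rule extensionalityI)
    show "merge {1..n} w (pverts D) A \<in> extensional (pverts D)" by (simp add: merge_def)
    show "\<kappa> \<in> extensional (pverts D)" using \<kappa>E by (simp add: PiE_def)
    fix v assume v: "v \<in> pverts D"
    show "merge {1..n} w (pverts D) A v = \<kappa> v"
    proof (rule set_eqI)
      fix c
      have "c \<in> \<kappa> v" if "i \<in> {1..n}" "w i = v" "c \<in> A i" for i
        using A[OF that(1)] that memP by blast
      moreover have "\<exists>i\<in>{1..n}. w i = v \<and> c \<in> A i" if "c \<in> \<kappa> v"
      proof -
        have p: "(c, v) \<in> P" using that v memP by simp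
        have i: "?r (c, v) \<in> {1..n}" using img p by blast
        show ?thesis using A[OF i] w[OF p] p i by (intro bexI[of _ "?r (c, v)"]) auto
      qed
      ultimately show "c \<in> merge {1..n} w (pverts D) A v \<longleftrightarrow> c \<in> \<kappa> v"
        unfolding mem_merge[OF v] by blast
    qed
  qed
  ultimately show ?thesis by (rule that)
qed

text \<open>This is the decomposition of set-valued \<open>P\<close>-partitions by linear multiextensions, for a
  labelling that decreases along arcs so that every arc imposes a strict inequality.\<close>

lemma Gamma_bar_sum_Lbar_set:
  "has_formal_sum (\<lambda>(n, w). Lbar_set n (descents l n w)) (linear_multiextensions D) (Gamma_bar D)"
proof -
  let ?I = "linear_multiextensions D"
  let ?L = "\<lambda>x. Lbar_maps (fst x) (descents l (fst x) (snd x))"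
  let ?\<phi> = "\<lambda>x. merge {1..fst x} (snd x) (pverts D)"
  have "has_formal_sum (\<lambda>x. formal_sum (xpow {1..fst x}) (?L x)) ?I
      (formal_sum (xpow (pverts D)) (increasing_set_maps D))"
  proof (rule has_formal_sum_xpow_by_bijection)
    show "increasing_set_maps D \<subseteq> pverts D \<rightarrow>\<^sub>E SetP" by (auto simp: increasing_set_maps_def)
    show "bij_betw (\<lambda>(x, A). ?\<phi> x A) (SIGMA x:?I. ?L x) (increasing_set_maps D)"
      unfolding bij_betw_def
    proof
      show "inj_on (\<lambda>(x, A). ?\<phi> x A) (SIGMA x:?I. ?L x)"
      proof (rule inj_onI)
        fix y y' assume yy': "y \<in> (SIGMA x:?I. ?L x)" "y' \<in> (SIGMA x:?I. ?L x)"
          "(case y of (x, A) \<Rightarrow> ?\<phi> x A) = (case y' of (x, A) \<Rightarrow> ?\<phi> x A)"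
        obtain n w A n' w' A' where "y = ((n, w), A)" "y' = ((n', w'), A')" by (metis surj_pair)
        then show "y = y'" using yy' word_merge_determined[of n w A n' w' A'] by auto
      qed
      show "(\<lambda>(x, A). ?\<phi> x A) ` (SIGMA x:?I. ?L x) = increasing_set_maps D"
      proof
        show "(\<lambda>(x, A). ?\<phi> x A) ` (SIGMA x:?I. ?L x) \<subseteq> increasing_set_maps D"
          using word_merge_increasing by auto
        show "increasing_set_maps D \<subseteq> (\<lambda>(x, A). ?\<phi> x A) ` (SIGMA x:?I. ?L x)"
        proof
          fix \<kappa> assume "\<kappa> \<in> increasing_set_maps D"
          then obtain n w A where "(n, w) \<in> ?I" "A \<in> Lbar_maps n (descents l n w)"
            "merge {1..n} w (pverts D) A = \<kappa>" by (rule word_merge_exists)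
          then show "\<kappa> \<in> (\<lambda>(x, A). ?\<phi> x A) ` (SIGMA x:?I. ?L x)"
            by (intro image_eqI[of _ _ "((n, w), A)"]) auto
        qed
      qed
    qed
    fix x A assume x: "x \<in> ?I" and A: "A \<in> ?L x"
    obtain n w where nw: "x = (n, w)" by (cases x)
    show "content (pverts D) (?\<phi> x A) = content {1..fst x} A"
      unfolding nw fst_conv snd_conv
    proof (rule content_merge)
      show "w ` {1..n} \<subseteq> pverts D" using x by (auto simp: nw linear_multiextensions_def)
      show "A \<in> {1..n} \<rightarrow>\<^sub>E SetP" using A by (simp add: nw Lbar_maps_def)
    qed (use fin x A nw multiextension_blocks_disjoint[of n w A] in auto)
  qed (rule fin)
  then show ?thesis
    by (simp add: Gamma_bar_def increasing_set_maps_def Lbar_set_def Lbar_maps_def case_prod_unfold)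
qed

end

text \<open>The number of proper descendants strictly decreases along arcs; an arbitrary enumeration of
  \<open>V\<close>, used as a second digit in base \<open>card V\<close>, makes the labels distinct.\<close>

lemma decreasing_labelling_exists:
  assumes V: "finite V" and E: "E \<subseteq> V \<times> V" "acyclic E"
  shows "\<exists>l :: 'v \<Rightarrow> nat. inj_on l V \<and> (\<forall>u v. (u, v) \<in> E \<longrightarrow> l v < l u)"
proof -
  obtain f :: "'v \<Rightarrow> nat" where f: "f ` V = {0..<card V}" "inj_on f V"
    using ex_bij_betw_finite_nat[OF V] by (auto simp: bij_betw_def)
  define h where "h u = card {v \<in> V. (u, v) \<in> E\<^sup>+}" for u
  \<comment> \<open>Since \<open>f u < card V\<close>, the term \<open>f u\<close> breaks ties without disturbing the order given by \<open>h\<close>.\<close>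
  define l where "l u = h u * card V + f u" for u
  have fV: "f u < card V" if "u \<in> V" for u using f(1) that by auto
  have "inj_on l V"
  proof (rule inj_onI)
    fix u v assume uv: "u \<in> V" "v \<in> V" "l u = l v"
    then have "l u mod card V = l v mod card V" by simp
    then have "f u = f v" using fV uv by (simp add: l_def)
    then show "u = v" using f(2) uv by (auto dest: inj_onD)
  qed
  moreover have "l v < l u" if uv: "(u, v) \<in> E" for u v
  proof -
    have V': "u \<in> V" "v \<in> V" using E uv by auto
    have "h v < h u" unfolding h_def
    proof (rule psubset_card_mono)
      have "v \<notin> {x \<in> V. (v, x) \<in> E\<^sup>+}" using E(2) by (simp add: acyclic_def)
      moreover have "v \<in> {x \<in> V. (u, x) \<in> E\<^sup>+}" using uv V' by auto
      moreover have "{x \<in> V. (v, x) \<in> E\<^sup>+} \<subseteq> {x \<in> V. (u, x) \<in> E\<^sup>+}"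
        using uv by (auto intro: trancl_into_trancl2)
      ultimately show "{x \<in> V. (v, x) \<in> E\<^sup>+} \<subset> {x \<in> V. (u, x) \<in> E\<^sup>+}" by blast
    qed (use V in simp)
    then have "h v * card V + card V \<le> h u * card V"
      by (metis Suc_leI add.commute mult_Suc mult_le_mono1)
    then show ?thesis using fV[OF V'(2)] by (simp add: l_def)
  qed
  ultimately show ?thesis by blast
qed

theorem Gamma_bar_multifundamental_positive:
  assumes "finite (pverts D)" "parcs D \<subseteq> pverts D \<times> pverts D" "acyclic (parcs D)"
  shows "multifundamental_positive (Gamma_bar D)"
proof -
  obtain l :: "_ \<Rightarrow> nat" where l: "inj_on l (pverts D)" "\<And>u v. (u, v) \<in> parcs D \<Longrightarrow> l v < l u"
    using decreasing_labelling_exists[OF assms] by blast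
  have "\<exists>\<alpha>. is_composition \<alpha> \<and> Lbar_set n (descents l n w) = Lbar \<alpha>" for n w
  proof -
    have "descents l n w \<subseteq> {1..n-1}" by (auto simp: descents_def)
    then obtain \<alpha> where "is_composition \<alpha>" "sum_list \<alpha> = n" "comp_set \<alpha> = descents l n w"
      by (rule composition_exists)
    then show ?thesis by (intro exI[of _ \<alpha>]) (simp add: Lbar_def)
  qed
  then obtain \<alpha> where \<alpha>: "\<And>n w. is_composition (\<alpha> n w)"
      "\<And>n w. Lbar_set n (descents l n w) = Lbar (\<alpha> n w)" by metis
  show ?thesis
  proof (rule multifundamental_positiveI)
    show "has_formal_sum (\<lambda>x. Lbar (\<alpha> (fst x) (snd x))) (linear_multiextensions D) (Gamma_bar D)"
      using Gamma_bar_sum_Lbar_set[of D l] assms l by (simp add: \<alpha>(2) case_prod_unfold)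
  qed (rule \<alpha>(1))
qed

section \<open>The Kromatic symmetric function\<close>

theorem corollary3p25:
  fixes G :: "'a pair_pre_digraph"
  assumes "pair_graph G"
  shows "has_formal_sum Gamma_bar (mAO G) (Kromatic G) \<and>
         multifundamental_positive (Kromatic G)"
proof
  show sum: "has_formal_sum Gamma_bar (mAO G) (Kromatic G)"
    using assms by (rule Kromatic_sum_Gamma_bar)
  show "multifundamental_positive (Kromatic G)"
  proof (rule multifundamental_positive_formal_sum[OF sum])
    fix D assume "D \<in> mAO G"
    then obtain \<alpha> where D: "multi_orientation \<alpha> G D" by (auto simp: mAO_iff)
    show "multifundamental_positive (Gamma_bar D)"
    proof (rule Gamma_bar_multifundamental_positive)
      show "finite (pverts D)"
        using pair_graph_finite[OF assms] by (simp add: multi_orientation_verts[OF D])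
      show "parcs D \<subseteq> pverts D \<times> pverts D" by (rule multi_orientation_wf[OF D])
      show "acyclic (parcs D)" using D by (simp add: multi_orientation_def acyclic_orientation_def)
    qed
  qed
qed

end
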